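(* Consider the finite-sum problem of minimizing $f=\sum_{v\in\mathcal V}\pi(v)f^v$ over $\Theta$, with recurrent data sampling $(v_n)_{n\ge1}$ (i.e. $\sup_{n\ge1}\|\mathbb E[\tau_{n,v}\mid\mathcal F_n]\|_\infty<\infty$ for every $v\in\mathcal V$), and assume that each $f^v$ is bounded below on $\Theta$ and that the directional derivative $\nabla f^v(\theta,\theta'-\theta)$ exists for all $v\in\mathcal V$ and $\theta,\theta'\in\Theta$. Then for every integer $N\ge1$: (i) If $(\theta_n)_{n\ge0}$ is generated by Algorithm 1 with constant regularization, with $\rho=0$ and with $\mu$-strongly convex surrogates, $\mu>0$, then $$\min_{1\le n\le N}\mathbb E[O_f(\theta_n)]\le \frac{L\,t_\odot\sqrt{2\Delta_0/\mu}}{\sqrt N}.$$ (ii) If $(\theta_n)_{n\ge0}$ is generated by Algorithm 1 with constant regularization and $\rho\le Lt_\odot\le\rho+\mu$, then $$\min_{1\le n\le N}\mathbb E[O_f(\theta_n)]\le 2\sqrt{\frac{2\Delta_0Lt_\odot}{N}}.$$ (iii) If $(\theta_n)_{n\ge0}$ is generated by Algorithm 1 with dynamic regularization and $\rho\le Lt_\odot\le\rho+\mu$, then $$\min_{1\le n\le N}\mathbb E[O_f(\theta_n)]\le 2\sqrt{\frac{2\Delta_0\big(Lt_\odot+(2t_{\rm hit}+1)\log_2(4|\mathcal V|)\big)}{N}}.$$ (iv) Assume in addition that each $f^v$ is continuously differentiable with $L$-Lipschitz gradient (same constant $L$ as for the surrogates), that $(r_n)_{n\ge1}$ is a non-increasing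 sequence of positive numbers with $\sum_{n}r_n=\infty$ and $\sum_n r_n^2<\infty$, and that $\pi_{\min}>0$. If $(\theta_n)_{n\ge0}$ is generated by Algorithm 2 with radii $(r_n)$, then, with $C_N=\sum_{n=1}^N r_n^2$, $$\min_{1\le n\le N}\mathbb E[O_f(\theta_n)]\le\frac{\Delta_0+\sqrt{\frac{2L}{\pi_{\min}}C_N\Delta_0}+(3+t_\odot)C_NL}{\sum_{n=1}^N(1\wedge r_{n+1})}.$$
   Context: Problem: $\mathcal V$ is a finite nonempty set, $\pi(v)\ge0$ with $\sum_{v\in\mathcal V}\pi(v)=1$, $\pi_{\min}=\min_v\pi(v)$; $\Theta\subseteq\mathbb R^p$ is a nonempty convex set (not necessarily compact); $f^v:\mathbb R^p\to\mathbb R$ for $v\in\mathcal V$ and $f=\sum_v\pi(v)f^v$. $\|\cdot\|$ is the Euclidean norm, $B_r(\theta)$ the closed ball, $a\wedge b=\min\{a,b\}$. Directional derivative and optimality: $\nabla f(\theta^*,\theta-\theta^* )=\lim_{\alpha\to0^+}\alpha^{-1}\big(f(\theta^*+\alpha(\theta-\theta^* ))-f(\theta^* )\big)$ and $O_f(\theta^* )=\sup_{\theta\in\Theta,\ \|\theta-\theta^*\|\le1}-\nabla f(\theta^*,\theta-\theta^* )$ for $\theta^*\in\Theta$. Surrogates: fix $L>0$. For $\phi:\mathbb R^p\to\mathbb R$ and $\theta\in\Theta$, $\mathcal S_L(\phi,\theta)$ is the set of convex functions $g:\mathbb R^p\to\mathbb R$ such that $g\ge\phi$ on $\Theta$, and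 $h=g-\phi$ is differentiable with $L$-Lipschitz gradient, $h(\theta)=0$, $\nabla h(\theta)=0$. For $\mu\ge0$, $\mathcal S_{L,\mu}(\phi,\theta)$ is the set of $\mu$-strongly convex $g\in\mathcal S_L(\phi,\theta)$ ($0$-strongly convex means convex). Sampling: $(v_n)_{n\ge1}$ is an arbitrary $\mathcal V$-valued stochastic process; $\tau_{n,v}=\inf\{j\ge1:v_{n+j}=v\}$; $k^v(n)=\sup\{1\le j\le n:v_j=v\}$, with $k^v(n)=1$ if $v$ was not visited by time $n$. $\mathcal F_n$ is the $\sigma$-algebra generated by $v_1,\dots,v_n,\theta_0,\dots,\theta_n$. $\|X\|_\infty=\inf\{t>0:\mathbb P(|X|>t)=0\}$. Define $t_{\rm hit}=\max_{v}\sup_{n\ge1}\|\mathbb E[\tau_{n,v}\mid\mathcal F_n]\|_\infty$ and $t_\odot=\sup_{n\ge1}\big\|\sum_{v}\mathbb E[\tau_{n,v}\mid\mathcal F_n]\pi(v)\big\|_\infty$. Algorithm 1 (parameters $\rho,\mu\ge0$): start from a fixed $\theta_0\in\Theta$ and $g_0^v\in\mathcal S_{L,\mu}(f^v,\theta_0)$ for all $v$. For $n\ge1$: observe $v_n$; choose $g_n^{v_n}\in\mathcal S_{L,\mu}(f^{v_n},\theta_{n-1})$, and set $g_n^v=g_{n-1}^v$ for $v\ne v_n$; set $\bar g_n=\sum_v\pi(v)g_n^v$; let $\theta_n\in\arg\min_{\theta\in\Theta}\big[\bar g_n(\theta)+\frac{\rho_n}2\|\theta-\theta_{n-1}\|^2\big]$,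 where $\rho_n=\rho$ (constant regularization) or $\rho_n=\rho+\max_{v}(n-k^v(n))$ (dynamic regularization). Algorithm 2 (radii $r_n>0$): the same with surrogates in $\mathcal S_L$ instead of $\mathcal S_{L,\mu}$, and with $\theta_n\in\arg\min_{\theta\in\Theta\cap B_{r_n}(\theta_{n-1})}\bar g_n(\theta)$. $\Delta_0=\bar g_0(\theta_0)-\inf_{\theta\in\Theta}f(\theta)$, where $\bar g_0=\sum_v\pi(v)g_0^v$. *)

theory Defs
  imports "HOL-Probability.Probability"
begin

definition has_dir_deriv :: "('a::real_normed_vector \<Rightarrow> real) \<Rightarrow> 'a \<Rightarrow> 'a \<Rightarrow> real \<Rightarrow> bool" where
  "has_dir_deriv \<phi> x d l \<longleftrightarrow> ((\<lambda>\<alpha>. (\<phi> (x + \<alpha> *\<^sub>R d) - \<phi> x) / \<alpha>) \<longlongrightarrow> l) (at_right 0)"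

definition dir_deriv :: "('a::real_normed_vector \<Rightarrow> real) \<Rightarrow> 'a \<Rightarrow> 'a \<Rightarrow> real" where
  "dir_deriv \<phi> x d = Lim (at_right 0) (\<lambda>\<alpha>. (\<phi> (x + \<alpha> *\<^sub>R d) - \<phi> x) / \<alpha>)"

text \<open>The optimality measure is extended-real valued, so that the supremum is meaningful
  even where the directional derivatives are unbounded.\<close>

definition opt_gap :: "'a::real_normed_vector set \<Rightarrow> ('a \<Rightarrow> real) \<Rightarrow> 'a \<Rightarrow> ereal" where
  "opt_gap \<Theta> \<phi> x = (SUP y\<in>{y\<in>\<Theta>. norm (y - x) \<le> 1}. ereal (- dir_deriv \<phi> x (y - x)))"

lemma opt_gap_nonneg:
  assumes "x \<in> \<Theta>"
  shows "0 \<le> opt_gap \<Theta> \<phi> x"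
proof -
  have "dir_deriv \<phi> x (x - x) = 0"
    unfolding dir_deriv_def by (rule tendsto_Lim) auto
  then have "0 = ereal (- dir_deriv \<phi> x (x - x))"
    by (simp add: zero_ereal_def)
  also have "\<dots> \<le> opt_gap \<Theta> \<phi> x"
    unfolding opt_gap_def by (rule SUP_upper) (use assms in auto)
  finally show ?thesis .
qed

text \<open>By \<open>opt_gap_nonneg\<close> the truncation of negative values in \<open>e2ennreal\<close> has no
  effect when \<open>X\<close> takes its values in \<open>\<Theta>\<close>.\<close>

definition expected_gap ::
  "'w measure \<Rightarrow> 'a::real_normed_vector set \<Rightarrow> ('a \<Rightarrow> real) \<Rightarrow> ('w \<Rightarrow> 'a) \<Rightarrow> ennreal" where
  "expected_gap M \<Theta> \<phi> X = (\<integral>\<^sup>+ \<omega>. e2ennreal (opt_gap \<Theta> \<phi> (X \<omega>)) \<partial>M)"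

definition mixture :: "('v::finite \<Rightarrow> real) \<Rightarrow> ('v \<Rightarrow> 'a \<Rightarrow> real) \<Rightarrow> 'a \<Rightarrow> real" where
  "mixture \<pi> \<phi> x = (\<Sum>w\<in>UNIV. \<pi> w * \<phi> w x)"

definition has_lipschitz_gradient :: "real \<Rightarrow> ('a::real_inner \<Rightarrow> real) \<Rightarrow> ('a \<Rightarrow> 'a) \<Rightarrow> bool" where
  "has_lipschitz_gradient L h G \<longleftrightarrow> (\<forall>x. GDERIV h x :> G x) \<and> L-lipschitz_on UNIV G"

definition strongly_convex :: "real \<Rightarrow> ('a::real_inner \<Rightarrow> real) \<Rightarrow> bool" where
  "strongly_convex \<mu> g \<longleftrightarrow> convex_on UNIV (\<lambda>x. g x - \<mu> / 2 * (norm x)\<^sup>2)"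

definition surrogates ::
  "'a::euclidean_space set \<Rightarrow> real \<Rightarrow> ('a \<Rightarrow> real) \<Rightarrow> 'a \<Rightarrow> ('a \<Rightarrow> real) set" where
  "surrogates \<Theta> L \<phi> x =
     {g. convex_on UNIV g \<and> (\<forall>y\<in>\<Theta>. \<phi> y \<le> g y) \<and> g x - \<phi> x = 0 \<and>
         (\<exists>G. has_lipschitz_gradient L (\<lambda>y. g y - \<phi> y) G \<and> G x = 0)}"

definition strong_surrogates ::
  "'a::euclidean_space set \<Rightarrow> real \<Rightarrow> real \<Rightarrow> ('a \<Rightarrow> real) \<Rightarrow> 'a \<Rightarrow> ('a \<Rightarrow> real) set" where
  "strong_surrogates \<Theta> L \<mu> \<phi> x = {g \<in> surrogates \<Theta> L \<phi> x. strongly_convex \<mu> g}"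

text \<open>In the next definitions \<open>v\<close>, \<open>\<theta>\<close> and \<open>g\<close> are deterministic sequences (a single sample
  path). The entry \<open>v 0\<close> of the sampling sequence is never used.
  The infimum of the empty set is \<open>\<infinity>\<close>.\<close>

definition hit_time :: "(nat \<Rightarrow> 'v) \<Rightarrow> nat \<Rightarrow> 'v \<Rightarrow> ennreal" where
  "hit_time v n w = (INF j\<in>{j. 1 \<le> j \<and> v (n + j) = w}. of_nat j)"

definition last_visit :: "(nat \<Rightarrow> 'v) \<Rightarrow> nat \<Rightarrow> 'v \<Rightarrow> nat" where
  "last_visit v n w =
     (if \<exists>j\<in>{1..n}. v j = w then Max {j\<in>{1..n}. v j = w} else 1)"

definition const_reg :: "real \<Rightarrow> (nat \<Rightarrow> 'v) \<Rightarrow> nat \<Rightarrow> real" where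
  "const_reg \<rho> v n = \<rho>"

definition dyn_reg :: "real \<Rightarrow> (nat \<Rightarrow> 'v::finite) \<Rightarrow> nat \<Rightarrow> real" where
  "dyn_reg \<rho> v n = \<rho> + (MAX w. real n - real (last_visit v n w))"

definition surrogate_updates ::
  "(('a \<Rightarrow> real) \<Rightarrow> 'a \<Rightarrow> ('a \<Rightarrow> real) set) \<Rightarrow> ('v \<Rightarrow> 'a \<Rightarrow> real) \<Rightarrow>
   (nat \<Rightarrow> 'v) \<Rightarrow> (nat \<Rightarrow> 'a) \<Rightarrow> (nat \<Rightarrow> 'v \<Rightarrow> 'a \<Rightarrow> real) \<Rightarrow> bool" where
  "surrogate_updates S f v \<theta> g \<longleftrightarrow>
     (\<forall>w. g 0 w \<in> S (f w) (\<theta> 0)) \<and>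
     (\<forall>n\<ge>1. g n (v n) \<in> S (f (v n)) (\<theta> (n - 1)) \<and>
             (\<forall>w. w \<noteq> v n \<longrightarrow> g n w = g (n - 1) w))"

definition algorithm1 ::
  "'a::euclidean_space set \<Rightarrow> ('v::finite \<Rightarrow> real) \<Rightarrow> ('v \<Rightarrow> 'a \<Rightarrow> real) \<Rightarrow> real \<Rightarrow> real \<Rightarrow>
   ((nat \<Rightarrow> 'v) \<Rightarrow> nat \<Rightarrow> real) \<Rightarrow>
   (nat \<Rightarrow> 'v) \<Rightarrow> (nat \<Rightarrow> 'a) \<Rightarrow> (nat \<Rightarrow> 'v \<Rightarrow> 'a \<Rightarrow> real) \<Rightarrow> bool" where
  "algorithm1 \<Theta> \<pi> f L \<mu> reg v \<theta> g \<longleftrightarrow>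
     \<theta> 0 \<in> \<Theta> \<and> surrogate_updates (strong_surrogates \<Theta> L \<mu>) f v \<theta> g \<and>
     (\<forall>n\<ge>1. is_arg_min (\<lambda>x. mixture \<pi> (g n) x + reg v n / 2 * (norm (x - \<theta> (n - 1)))\<^sup>2)
                       (\<lambda>x. x \<in> \<Theta>) (\<theta> n))"

definition algorithm2 ::
  "'a::euclidean_space set \<Rightarrow> ('v::finite \<Rightarrow> real) \<Rightarrow> ('v \<Rightarrow> 'a \<Rightarrow> real) \<Rightarrow> real \<Rightarrow> (nat \<Rightarrow> real) \<Rightarrow>
   (nat \<Rightarrow> 'v) \<Rightarrow> (nat \<Rightarrow> 'a) \<Rightarrow> (nat \<Rightarrow> 'v \<Rightarrow> 'a \<Rightarrow> real) \<Rightarrow> bool" where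
  "algorithm2 \<Theta> \<pi> f L r v \<theta> g \<longleftrightarrow>
     \<theta> 0 \<in> \<Theta> \<and> surrogate_updates (surrogates \<Theta> L) f v \<theta> g \<and>
     (\<forall>n\<ge>1. is_arg_min (mixture \<pi> (g n)) (\<lambda>x. x \<in> \<Theta> \<inter> cball (\<theta> (n - 1)) (r n)) (\<theta> n))"

text \<open>From here on \<open>v\<close> and \<open>\<theta>\<close> are stochastic processes on the probability space \<open>M\<close>.\<close>

definition history ::
  "'w measure \<Rightarrow> (nat \<Rightarrow> 'w \<Rightarrow> 'v) \<Rightarrow> (nat \<Rightarrow> 'w \<Rightarrow> 'a::topological_space) \<Rightarrow> nat \<Rightarrow> 'w measure" where
  "history M v \<theta> n = sigma (space M)
     ((\<Union>i\<in>{1..n}. {v i -` A \<inter> space M | A. A \<in> UNIV}) \<union>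
      (\<Union>i\<in>{0..n}. {\<theta> i -` B \<inter> space M | B. B \<in> sets borel}))"

definition cond_hit ::
  "'w measure \<Rightarrow> (nat \<Rightarrow> 'w \<Rightarrow> 'v) \<Rightarrow> (nat \<Rightarrow> 'w \<Rightarrow> 'a::topological_space) \<Rightarrow>
   nat \<Rightarrow> 'v \<Rightarrow> 'w \<Rightarrow> ennreal" where
  "cond_hit M v \<theta> n w = nn_cond_exp M (history M v \<theta> n) (\<lambda>\<omega>. hit_time (\<lambda>i. v i \<omega>) n w)"

lemma subalgebra_history:
  assumes v: "\<And>n. 1 \<le> n \<Longrightarrow> v n \<in> measurable M (count_space UNIV)"
    and \<theta>: "\<And>n. \<theta> n \<in> borel_measurable M"
  shows "subalgebra M (history M v \<theta> n)"
proof -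
  have "(\<Union>i\<in>{1..n}. {v i -` A \<inter> space M | A. A \<in> UNIV}) \<union>
      (\<Union>i\<in>{0..n}. {\<theta> i -` B \<inter> space M | B. B \<in> sets borel}) \<subseteq> sets M"
    using v \<theta> by (auto intro: measurable_sets)
  from sets.sigma_sets_subset[OF this] show ?thesis
    unfolding subalgebra_def history_def by (auto simp: sets_measure_of_conv)
qed

lemma hit_time_measurable:
  fixes v :: "nat \<Rightarrow> 'w \<Rightarrow> 'v"
  assumes v: "\<And>n. 1 \<le> n \<Longrightarrow> v n \<in> measurable M (count_space UNIV)"
  shows "(\<lambda>\<omega>. hit_time (\<lambda>i. v i \<omega>) n w) \<in> borel_measurable M"
proof -
  have eq: "hit_time (\<lambda>i. v i \<omega>) n w = (INF j\<in>{1..}. if v (n + j) \<omega> = w then of_nat j else top)" for \<omega>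
    unfolding hit_time_def
  proof (rule antisym)
    show "(INF j\<in>{j. 1 \<le> j \<and> v (n + j) \<omega> = w}. of_nat j)
        \<le> (INF j\<in>{1..}. if v (n + j) \<omega> = w then of_nat j else top :: ennreal)"
      by (rule INF_greatest) (simp add: INF_lower)
    show "(INF j\<in>{1..}. if v (n + j) \<omega> = w then of_nat j else top :: ennreal)
        \<le> (INF j\<in>{j. 1 \<le> j \<and> v (n + j) \<omega> = w}. of_nat j)"
      by (rule INF_mono) auto
  qed
  have "(\<lambda>\<omega>. if v (n + j) \<omega> = w then of_nat j else top :: ennreal) \<in> borel_measurable M"
    if "j \<in> {1..}" for j
    using v[of "n + j"] that by simp
  then show ?thesis
    unfolding eq by (intro borel_measurable_INF) auto
qed

text \<open>All random variables here are nonnegative, so the essential supremum is the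
  \<open>L\<^sup>\<infinity>\<close> norm.\<close>

definition recurrent ::
  "'w measure \<Rightarrow> (nat \<Rightarrow> 'w \<Rightarrow> 'v) \<Rightarrow> (nat \<Rightarrow> 'w \<Rightarrow> 'a::topological_space) \<Rightarrow> bool" where
  "recurrent M v \<theta> \<longleftrightarrow> (\<forall>w. (SUP n\<in>{1..}. esssup M (cond_hit M v \<theta> n w)) < \<infinity>)"

definition t_hit ::
  "'w measure \<Rightarrow> (nat \<Rightarrow> 'w \<Rightarrow> 'v::finite) \<Rightarrow> (nat \<Rightarrow> 'w \<Rightarrow> 'a::topological_space) \<Rightarrow> ennreal" where
  "t_hit M v \<theta> = (MAX w. SUP n\<in>{1..}. esssup M (cond_hit M v \<theta> n w))"

definition t_odot ::
  "'w measure \<Rightarrow> ('v::finite \<Rightarrow> real) \<Rightarrow> (nat \<Rightarrow> 'w \<Rightarrow> 'v) \<Rightarrow> (nat \<Rightarrow> 'w \<Rightarrow> 'a::topological_space) \<Rightarrow>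
   ennreal" where
  "t_odot M \<pi> v \<theta> =
     (SUP n\<in>{1..}. esssup M (\<lambda>\<omega>. \<Sum>w\<in>UNIV. cond_hit M v \<theta> n w \<omega> * ennreal (\<pi> w)))"

text \<open>Both quantities are finite for recurrent sampling, so applying \<open>enn2real\<close> loses
  nothing.\<close>

lemma t_hit_finite:
  assumes "recurrent M v \<theta>"
  shows "t_hit M v \<theta> < \<infinity>"
  using assms unfolding t_hit_def recurrent_def by (subst Max_less_iff) auto

lemma t_odot_finite:
  assumes rec: "recurrent M v \<theta>" and \<pi>: "(\<Sum>w\<in>UNIV. \<pi> w) = 1" "\<And>w. 0 \<le> \<pi> w"
  shows "t_odot M \<pi> v \<theta> < \<infinity>"
proof -
  have meas: "cond_hit M v \<theta> n w \<in> borel_measurable M" for n w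
    unfolding cond_hit_def by simp
  have "t_odot M \<pi> v \<theta> \<le> t_hit M v \<theta>"
    unfolding t_odot_def
  proof (intro SUP_least esssup_I)
    fix n :: nat assume n: "n \<in> {1..}"
    show "(\<lambda>\<omega>. \<Sum>w\<in>UNIV. cond_hit M v \<theta> n w \<omega> * ennreal (\<pi> w)) \<in> borel_measurable M"
      using meas by measurable
    have le: "esssup M (cond_hit M v \<theta> n w) \<le> t_hit M v \<theta>" for w
      unfolding t_hit_def by (rule order_trans[OF SUP_upper[OF n] Max_ge]) auto
    have "AE \<omega> in M. \<forall>w\<in>UNIV. cond_hit M v \<theta> n w \<omega> \<le> t_hit M v \<theta>"
    proof (intro AE_finite_allI)
      fix w show "AE \<omega> in M. cond_hit M v \<theta> n w \<omega> \<le> t_hit M v \<theta>"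
        using esssup_AE[of "cond_hit M v \<theta> n w" M] le[of w] by (auto elim: eventually_mono)
    qed simp
    then show "AE \<omega> in M. (\<Sum>w\<in>UNIV. cond_hit M v \<theta> n w \<omega> * ennreal (\<pi> w)) \<le> t_hit M v \<theta>"
    proof eventually_elim
      case (elim \<omega>)
      have "(\<Sum>w\<in>UNIV. cond_hit M v \<theta> n w \<omega> * ennreal (\<pi> w))
          \<le> (\<Sum>w\<in>UNIV. t_hit M v \<theta> * ennreal (\<pi> w))"
        using elim by (intro sum_mono mult_right_mono) auto
      also have "\<dots> = t_hit M v \<theta>"
        using \<pi> by (simp add: sum_distrib_left[symmetric] sum_ennreal)
      finally show ?case .
    qed
  qed
  with t_hit_finite[OF rec] show ?thesis by (rule order_le_less_trans[rotated])
qed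

definition initial_gap ::
  "'a set \<Rightarrow> ('v::finite \<Rightarrow> real) \<Rightarrow> ('v \<Rightarrow> 'a \<Rightarrow> real) \<Rightarrow> ('v \<Rightarrow> 'a \<Rightarrow> real) \<Rightarrow> 'a \<Rightarrow> real" where
  "initial_gap \<Theta> \<pi> f g0 \<theta>0 = mixture \<pi> g0 \<theta>0 - (INF x\<in>\<Theta>. mixture \<pi> f x)"

end

theory Submission
  imports Defs
begin

text \<open>
  If \<open>h\<close> is the averaged surrogate error, first-order optimality of \<open>\<theta> n\<close> bounds the optimality gap
  at \<open>\<theta> n\<close> by the norm of \<open>\<nabla>h\<close> there plus the regularization term. Since the surrogate of \<open>f w\<close>
  was last refreshed at time \<open>k = last_visit v n w\<close>, that norm is at most \<open>L\<close> times the \<open>\<pi>\<close>-average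
  of the path lengths of the iterates from \<open>k - 1\<close> to \<open>n\<close>. After summing over \<open>n\<close>, the increment at
  time \<open>i\<close> is counted for \<open>w\<close> at most as often as it takes to visit \<open>w\<close> after time \<open>i\<close>; being
  measurable with respect to the history up to \<open>i\<close>, it may be integrated against the conditional
  expectation of this hitting time, so the total is at most \<open>L t\<^sub>\<odot>\<close> times the expected sum of the
  increments.

  For Algorithm 1 the surrogate values decrease along the iteration by the (weighted) squared
  increments, and Cauchy--Schwarz concludes. Under dynamic regularization one needs in addition that
  the oldest surrogate has expected age at most \<open>(2 t_hit + 1) log\<^sub>2 (4 |V|)\<close>: a fixed \<open>w\<close> stays
  unvisited during \<open>k\<close> blocks of length \<open>2 t_hit\<close> with probability at most \<open>2\<^sup>-\<^sup>k\<close>.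
  For Algorithm 2 the increments are at most the radii, and comparing \<open>\<theta> (n + 1)\<close> with the point at
  distance \<open>min 1 (r (n + 1))\<close> from \<open>\<theta> n\<close> bounds the gap at \<open>\<theta> n\<close> by a telescoping sum.
\<close>

section \<open>Lower integrals\<close>

lemma simple_integral_le_nn_integral:
  assumes "simple_function M s" "s \<le> f"
  shows "integral\<^sup>S M s \<le> (\<integral>\<^sup>+x. f x \<partial>M)"
  unfolding nn_integral_def by (rule SUP_upper) (use assms in auto)

text \<open>For functions that are not measurable the Lebesgue integral of the library is the lower
  integral, which is still superadditive; no measurability of the optimality gap is needed.\<close>

lemma nn_integral_superadditive:
  "(\<integral>\<^sup>+x. f x \<partial>M) + (\<integral>\<^sup>+x. g x \<partial>M) \<le> (\<integral>\<^sup>+x. f x + g x \<partial>M)"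
proof -
  define A where "A f = {s. simple_function M s \<and> s \<le> f}" for f :: "'a \<Rightarrow> ennreal"
  have ne: "A f \<noteq> {}" for f
    unfolding A_def by (auto intro!: exI[of _ "\<lambda>x. 0"] simp: le_fun_def)
  have le: "integral\<^sup>S M s + integral\<^sup>S M t \<le> (\<integral>\<^sup>+x. f x + g x \<partial>M)" if "s \<in> A f" "t \<in> A g" for s t
  proof -
    have "integral\<^sup>S M s + integral\<^sup>S M t = integral\<^sup>S M (\<lambda>x. s x + t x)"
      using that unfolding A_def by (subst simple_integral_add) auto
    also have "\<dots> \<le> (\<integral>\<^sup>+x. f x + g x \<partial>M)"
      using that unfolding A_def
      by (intro simple_integral_le_nn_integral) (auto simp: le_fun_def intro!: add_mono)
    finally show ?thesis .
  qed
  have "(\<integral>\<^sup>+x. f x \<partial>M) + (\<integral>\<^sup>+x. g x \<partial>M) =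
      (SUP s\<in>A f. SUP t\<in>A g. integral\<^sup>S M s + integral\<^sup>S M t)"
    unfolding nn_integral_def A_def[symmetric]
    by (subst ennreal_SUP_add_left[OF ne, symmetric], subst ennreal_SUP_add_right[OF ne, symmetric]) simp
  also have "\<dots> \<le> (\<integral>\<^sup>+x. f x + g x \<partial>M)"
    by (intro SUP_least le)
  finally show ?thesis .
qed

text \<open>Scaling a simple function below \<open>f\<close> by \<open>c\<close> gives a simple
  function below \<open>c * f\<close>, so this direction survives for lower integrals.\<close>

lemma nn_integral_cmult_superadditive:
  "c * (\<integral>\<^sup>+x. f x \<partial>M) \<le> (\<integral>\<^sup>+x. c * f x \<partial>M)"
proof -
  have "integral\<^sup>S M s * c \<le> (\<integral>\<^sup>+x. c * f x \<partial>M)" if "simple_function M s" "s \<le> f" for s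
  proof -
    have "integral\<^sup>S M s * c = integral\<^sup>S M (\<lambda>x. c * s x)"
      using that by (subst simple_integral_mult) (auto simp: mult.commute)
    also have "\<dots> \<le> (\<integral>\<^sup>+x. c * f x \<partial>M)"
      using that by (intro simple_integral_le_nn_integral) (auto simp: le_fun_def intro!: mult_left_mono)
    finally show ?thesis .
  qed
  then show ?thesis
    unfolding nn_integral_def[of M f] SUP_mult_left_ennreal
    by (intro SUP_least) (auto simp: mult.commute)
qed

lemma nn_integral_sum_superadditive:
  fixes f :: "'i \<Rightarrow> 'a \<Rightarrow> ennreal"
  assumes "finite I"
  shows "(\<Sum>i\<in>I. c i * (\<integral>\<^sup>+x. f i x \<partial>M)) \<le> (\<integral>\<^sup>+x. (\<Sum>i\<in>I. c i * f i x) \<partial>M)"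
  using assms
proof (induction I)
  case (insert i I)
  have "(\<Sum>i\<in>insert i I. c i * (\<integral>\<^sup>+x. f i x \<partial>M))
      \<le> (\<integral>\<^sup>+x. c i * f i x \<partial>M) + (\<integral>\<^sup>+x. (\<Sum>i\<in>I. c i * f i x) \<partial>M)"
    using insert by (auto intro!: add_mono nn_integral_cmult_superadditive)
  also have "\<dots> \<le> (\<integral>\<^sup>+x. (\<Sum>i\<in>insert i I. c i * f i x) \<partial>M)"
    using insert nn_integral_superadditive by simp
  finally show ?case .
qed simp

text \<open>A minimum is at most any weighted mean. Superadditivity moves the weighted sum under the
  lower integral, so one bound for the summed gaps controls the smallest expected gap.\<close>

lemma Min_nn_integral_le:
  fixes X :: "nat \<Rightarrow> 'a \<Rightarrow> ennreal" and b :: "nat \<Rightarrow> real"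
  assumes I: "finite I" "I \<noteq> {}" and b: "\<And>n. n \<in> I \<Longrightarrow> 0 < b n"
    and le: "(\<integral>\<^sup>+\<omega>. (\<Sum>n\<in>I. ennreal (b n) * X n \<omega>) \<partial>M) \<le> ennreal B"
  shows "(MIN n\<in>I. \<integral>\<^sup>+\<omega>. X n \<omega> \<partial>M) \<le> ennreal (B / (\<Sum>n\<in>I. b n))"
proof -
  let ?m = "MIN n\<in>I. \<integral>\<^sup>+\<omega>. X n \<omega> \<partial>M"
  have pos: "0 < (\<Sum>n\<in>I. b n)"
    using I b by (intro sum_pos) auto
  have "ennreal (\<Sum>n\<in>I. b n) * ?m = (\<Sum>n\<in>I. ennreal (b n) * ?m)"
    using b by (simp add: sum_distrib_right[symmetric] sum_ennreal less_imp_le)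
  also have "\<dots> \<le> (\<Sum>n\<in>I. ennreal (b n) * (\<integral>\<^sup>+\<omega>. X n \<omega> \<partial>M))"
    using I by (intro sum_mono mult_left_mono Min_le) auto
  also have "\<dots> \<le> (\<integral>\<^sup>+\<omega>. (\<Sum>n\<in>I. ennreal (b n) * X n \<omega>) \<partial>M)"
    using I by (rule_tac nn_integral_sum_superadditive)
  also note le
  finally have "ennreal (\<Sum>n\<in>I. b n) * ?m \<le> ennreal B" .
  then have "(?m * ennreal (\<Sum>n\<in>I. b n)) / ennreal (\<Sum>n\<in>I. b n) \<le> ennreal B / ennreal (\<Sum>n\<in>I. b n)"
    by (intro divide_right_mono_ennreal) (simp add: mult.commute)
  then have "?m \<le> ennreal B / ennreal (\<Sum>n\<in>I. b n)"
    using pos by (subst (asm) ennreal_mult_divide_eq) auto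
  \<comment> \<open>For \<open>B < 0\<close> both sides are \<open>0\<close>, because
    \<open>ennreal\<close> truncates negative reals.\<close>
  also have "\<dots> = ennreal (B / (\<Sum>n\<in>I. b n))"
    using pos by (cases "0 \<le> B") (auto simp: divide_ennreal ennreal_neg divide_nonpos_pos)
  finally show ?thesis .
qed

section \<open>Directional derivatives, convexity and smoothness\<close>

lemma dir_deriv_eqI:
  assumes "has_dir_deriv \<phi> x d l"
  shows "dir_deriv \<phi> x d = l"
  using assms unfolding has_dir_deriv_def dir_deriv_def by (intro tendsto_Lim) auto

lemma has_dir_deriv_add:
  assumes "has_dir_deriv \<phi> x d l" "has_dir_deriv \<psi> x d k"
  shows "has_dir_deriv (\<lambda>y. \<phi> y + \<psi> y) x d (l + k)"
  using tendsto_add[OF assms[unfolded has_dir_deriv_def]]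
  unfolding has_dir_deriv_def by (simp add: add_divide_distrib[symmetric] algebra_simps)

lemma has_dir_deriv_mixture:
  assumes "\<And>w. has_dir_deriv (\<phi> w) x d (l w)"
  shows "has_dir_deriv (mixture \<pi> \<phi>) x d (\<Sum>w\<in>UNIV. \<pi> w * l w)"
proof -
  have "((\<lambda>\<alpha>. \<Sum>w\<in>UNIV. \<pi> w * ((\<phi> w (x + \<alpha> *\<^sub>R d) - \<phi> w x) / \<alpha>)) \<longlongrightarrow> (\<Sum>w\<in>UNIV. \<pi> w * l w)) (at_right 0)"
    using assms unfolding has_dir_deriv_def by (intro tendsto_intros)
  moreover have "(\<Sum>w\<in>UNIV. \<pi> w * ((\<phi> w (x + \<alpha> *\<^sub>R d) - \<phi> w x) / \<alpha>)) =
      (mixture \<pi> \<phi> (x + \<alpha> *\<^sub>R d) - mixture \<pi> \<phi> x) / \<alpha>" for \<alpha>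
    unfolding mixture_def
    by (simp add: sum_subtractf[symmetric] sum_divide_distrib algebra_simps diff_divide_distrib)
  ultimately show ?thesis
    unfolding has_dir_deriv_def by simp
qed

lemma gderiv_along_line:
  assumes "GDERIV \<phi> (x + t *\<^sub>R d) :> G"
  shows "((\<lambda>\<alpha>. \<phi> (x + \<alpha> *\<^sub>R d)) has_real_derivative inner d G) (at t)"
proof -
  have "((\<lambda>\<alpha>. x + \<alpha> *\<^sub>R d) has_derivative (\<lambda>h. h *\<^sub>R d)) (at t)"
    by (auto intro!: derivative_eq_intros)
  moreover have "(\<phi> has_derivative (\<lambda>h. inner h G)) (at (x + t *\<^sub>R d))"
    using assms unfolding gderiv_def .
  ultimately have "((\<lambda>\<alpha>. \<phi> (x + \<alpha> *\<^sub>R d)) has_derivative (\<lambda>h. inner (h *\<^sub>R d) G)) (at t)"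
    by (rule has_derivative_compose)
  then show ?thesis
    unfolding has_field_derivative_def by (simp add: mult_commute_abs)
qed

lemma has_dir_deriv_gderiv:
  assumes "GDERIV \<phi> x :> G"
  shows "has_dir_deriv \<phi> x d (inner d G)"
proof -
  have "((\<lambda>\<alpha>. \<phi> (x + \<alpha> *\<^sub>R d)) has_real_derivative inner d G) (at 0)"
    using assms by (intro gderiv_along_line) simp
  then have "((\<lambda>\<alpha>. (\<phi> (x + \<alpha> *\<^sub>R d) - \<phi> x) / \<alpha>) \<longlongrightarrow> inner d G) (at 0)"
    unfolding has_field_derivative_iff by simp
  then show ?thesis
    unfolding has_dir_deriv_def by (rule filterlim_mono) (auto simp: at_le)
qed

lemma opt_gap_le:
  assumes "\<And>y. y \<in> \<Theta> \<Longrightarrow> norm (y - x) \<le> 1 \<Longrightarrow> - dir_deriv \<phi> x (y - x) \<le> B"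
  shows "e2ennreal (opt_gap \<Theta> \<phi> x) \<le> ennreal B"
proof -
  have "opt_gap \<Theta> \<phi> x \<le> ereal B"
    unfolding opt_gap_def using assms by (intro SUP_least) auto
  then show ?thesis
    using e2ennreal_mono by fastforce
qed

text \<open>Short steps toward \<open>y\<close> stay in \<open>\<Theta>\<close> by convexity, so
  minimality makes the difference quotients nonnegative and the limit inherits the sign.\<close>

lemma argmin_dir_deriv_nonneg:
  assumes min: "is_arg_min \<phi> (\<lambda>x. x \<in> \<Theta>) x" and cvx: "convex \<Theta>" and y: "y \<in> \<Theta>"
    and l: "has_dir_deriv \<phi> x (y - x) l"
  shows "0 \<le> l"
proof (rule tendsto_lowerbound)
  show "((\<lambda>\<alpha>. (\<phi> (x + \<alpha> *\<^sub>R (y - x)) - \<phi> x) / \<alpha>) \<longlongrightarrow> l) (at_right 0)"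
    using l unfolding has_dir_deriv_def .
  have x: "x \<in> \<Theta>" and le: "\<And>z. z \<in> \<Theta> \<Longrightarrow> \<phi> x \<le> \<phi> z"
    using min by (auto simp: is_arg_min_linorder)
  have "0 \<le> (\<phi> (x + \<alpha> *\<^sub>R (y - x)) - \<phi> x) / \<alpha>" if "\<alpha> \<in> {0<..<1}" for \<alpha>
  proof -
    have "x + \<alpha> *\<^sub>R (y - x) = (1 - \<alpha>) *\<^sub>R x + \<alpha> *\<^sub>R y"
      by (simp add: algebra_simps)
    also have "\<dots> \<in> \<Theta>"
      using convexD[OF cvx x y, of "1 - \<alpha>" \<alpha>] that by auto
    finally show ?thesis
      using le that by auto
  qed
  moreover have "eventually (\<lambda>\<alpha>. \<alpha> \<in> {0<..<1}) (at_right (0::real))"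
    by (rule eventually_at_right_real) simp
  ultimately show "eventually (\<lambda>\<alpha>. 0 \<le> (\<phi> (x + \<alpha> *\<^sub>R (y - x)) - \<phi> x) / \<alpha>) (at_right 0)"
    by (auto elim: eventually_mono)
qed auto

lemma gderiv_proximal_term:
  fixes c x :: "'a::real_inner"
  shows "GDERIV (\<lambda>y. \<rho> / 2 * (norm (y - c))\<^sup>2) x :> \<rho> *\<^sub>R (x - c)"
  unfolding gderiv_def power2_norm_eq_inner
  by (auto intro!: derivative_eq_intros ext simp: inner_commute algebra_simps)

text \<open>The definition makes \<open>g\<close> minus a quadratic convex; the exact expansion of
  the squared norm of a convex combination turns this into the usual inequality with its quadratic
  correction.\<close>

lemma strongly_convex_combination:
  fixes g :: "'a::real_inner \<Rightarrow> real"
  assumes "strongly_convex \<mu> g" and t: "0 \<le> t" "t \<le> 1"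
  shows "g ((1 - t) *\<^sub>R x + t *\<^sub>R y) \<le> (1 - t) * g x + t * g y - \<mu> / 2 * (t * (1 - t)) * (norm (x - y))\<^sup>2"
proof -
  have le: "g ((1 - t) *\<^sub>R x + t *\<^sub>R y) - \<mu> / 2 * (norm ((1 - t) *\<^sub>R x + t *\<^sub>R y))\<^sup>2
      \<le> (1 - t) * (g x - \<mu> / 2 * (norm x)\<^sup>2) + t * (g y - \<mu> / 2 * (norm y)\<^sup>2)"
    using convex_onD[OF assms(1)[unfolded strongly_convex_def] t, of x y] by simp
  have eq: "(norm ((1 - t) *\<^sub>R x + t *\<^sub>R y))\<^sup>2 =
      (1 - t) * (norm x)\<^sup>2 + t * (norm y)\<^sup>2 - t * (1 - t) * (norm (x - y))\<^sup>2"
    unfolding power2_norm_eq_inner by (simp add: inner_simps inner_commute algebra_simps)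
  show ?thesis
    using le unfolding eq by (simp add: field_simps)
qed

text \<open>The squared distance to \<open>c\<close> differs from the squared norm by an affine
  function, so the proximal term adds exactly \<open>\<rho>\<close> to the modulus.\<close>

lemma strongly_convex_proximal:
  fixes g :: "'a::real_inner \<Rightarrow> real"
  assumes "strongly_convex \<mu> g"
  shows "strongly_convex (\<mu> + \<rho>) (\<lambda>x. g x + \<rho> / 2 * (norm (x - c))\<^sup>2)"
proof -
  have eq: "g x + \<rho> / 2 * (norm (x - c))\<^sup>2 - (\<mu> + \<rho>) / 2 * (norm x)\<^sup>2
      = (g x - \<mu> / 2 * (norm x)\<^sup>2) + (\<rho> / 2 * (norm c)\<^sup>2 - inner x (\<rho> *\<^sub>R c))" for x
    unfolding power2_norm_eq_inner by (simp add: inner_simps inner_commute field_simps)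
  have "convex_on UNIV (\<lambda>x. \<rho> / 2 * (norm c)\<^sup>2 - inner x (\<rho> *\<^sub>R c))"
    by (auto intro!: convex_onI simp: inner_simps field_simps)
  with assms show ?thesis
    unfolding strongly_convex_def eq by (intro convex_on_add) auto
qed

text \<open>Quadratic growth at a constrained minimizer: compare \<open>x\<close> with the point at
  fraction \<open>t\<close> of the way to \<open>y\<close>, divide by \<open>t\<close>, and let
  \<open>t\<close> tend to zero.\<close>

lemma strongly_convex_argmin:
  fixes \<phi> :: "'a::real_inner \<Rightarrow> real"
  assumes sc: "strongly_convex m \<phi>" and min: "is_arg_min \<phi> (\<lambda>x. x \<in> \<Theta>) x"
    and cvx: "convex \<Theta>" and y: "y \<in> \<Theta>"
  shows "\<phi> x + m / 2 * (norm (x - y))\<^sup>2 \<le> \<phi> y"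
proof -
  have x: "x \<in> \<Theta>" and le: "\<And>z. z \<in> \<Theta> \<Longrightarrow> \<phi> x \<le> \<phi> z"
    using min by (auto simp: is_arg_min_linorder)
  have "m / 2 * (1 - t) * (norm (x - y))\<^sup>2 \<le> \<phi> y - \<phi> x" if t: "t \<in> {0<..<1}" for t
  proof -
    have "\<phi> x \<le> \<phi> ((1 - t) *\<^sub>R x + t *\<^sub>R y)"
      using convexD[OF cvx x y, of "1 - t" t] t by (intro le) auto
    also have "\<dots> \<le> (1 - t) * \<phi> x + t * \<phi> y - m / 2 * (t * (1 - t)) * (norm (x - y))\<^sup>2"
      using t by (intro strongly_convex_combination[OF sc]) auto
    finally have "t * (m / 2 * (1 - t) * (norm (x - y))\<^sup>2) \<le> t * (\<phi> y - \<phi> x)"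
      by (simp add: algebra_simps)
    then show ?thesis
      using t by simp
  qed
  moreover have "eventually (\<lambda>t. t \<in> {0<..<1}) (at_right (0::real))"
    by (rule eventually_at_right_real) simp
  ultimately have "eventually (\<lambda>t. m / 2 * (1 - t) * (norm (x - y))\<^sup>2 \<le> \<phi> y - \<phi> x) (at_right 0)"
    by (auto elim: eventually_mono)
  moreover have "((\<lambda>t. m / 2 * (1 - t) * (norm (x - y))\<^sup>2) \<longlongrightarrow> m / 2 * (1 - 0) * (norm (x - y))\<^sup>2) (at_right 0)"
    by (intro tendsto_intros)
  ultimately have "m / 2 * (1 - 0) * (norm (x - y))\<^sup>2 \<le> \<phi> y - \<phi> x"
    by (intro tendsto_upperbound) auto
  then show ?thesis by simp
qed

text \<open>Along the segment from \<open>x\<close> to \<open>x + d\<close>, the difference between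
  \<open>\<phi>\<close> and the claimed quadratic has nonpositive derivative, by Cauchy-Schwarz and
  the Lipschitz bound on \<open>G\<close>.\<close>

lemma smooth_upper_bound:
  assumes "has_lipschitz_gradient K \<phi> G"
  shows "\<phi> (x + d) \<le> \<phi> x + inner d (G x) + K / 2 * (norm d)\<^sup>2"
proof -
  have D: "\<And>z. GDERIV \<phi> z :> G z" and lip: "K-lipschitz_on UNIV G"
    using assms unfolding has_lipschitz_gradient_def by auto
  let ?\<psi> = "\<lambda>t. \<phi> (x + t *\<^sub>R d) - t * inner d (G x) - K / 2 * t\<^sup>2 * (norm d)\<^sup>2"
  have "?\<psi> 1 \<le> ?\<psi> 0"
  proof (rule DERIV_nonpos_imp_nonincreasing[of 0 1 ?\<psi>])
    fix t :: real assume t: "0 \<le> t" "t \<le> 1"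
    have "(?\<psi> has_real_derivative
        (inner d (G (x + t *\<^sub>R d)) - inner d (G x) - K * t * (norm d)\<^sup>2)) (at t)"
      by (auto intro!: derivative_eq_intros gderiv_along_line[OF D])
    moreover have "inner d (G (x + t *\<^sub>R d)) - inner d (G x) \<le> K * t * (norm d)\<^sup>2"
    proof -
      have "inner d (G (x + t *\<^sub>R d)) - inner d (G x) \<le> norm d * norm (G (x + t *\<^sub>R d) - G x)"
        using norm_cauchy_schwarz by (simp add: inner_diff_right[symmetric])
      also have "\<dots> \<le> norm d * (K * norm (t *\<^sub>R d))"
        using lipschitz_onD[OF lip, of "x + t *\<^sub>R d" x] by (intro mult_left_mono) (auto simp: dist_norm)
      also have "\<dots> = K * t * (norm d)\<^sup>2"
        using t by (simp add: power2_eq_square)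
      finally show ?thesis .
    qed
    ultimately show "\<exists>z. (?\<psi> has_real_derivative z) (at t) \<and> z \<le> 0"
      by (intro exI[of _ "inner d (G (x + t *\<^sub>R d)) - inner d (G x) - K * t * (norm d)\<^sup>2"]) auto
  qed simp
  then show ?thesis by simp
qed

lemma gderiv_mixture:
  assumes "\<And>w. GDERIV (\<phi> w) x :> G w"
  shows "GDERIV (mixture \<pi> \<phi>) x :> (\<Sum>w\<in>UNIV. \<pi> w *\<^sub>R G w)"
proof -
  have "(mixture \<pi> \<phi> has_derivative (\<lambda>h. \<Sum>w\<in>UNIV. \<pi> w * inner h (G w))) (at x)"
    using assms unfolding mixture_def[abs_def] gderiv_def
    by (intro has_derivative_sum has_derivative_mult_right)
  then show ?thesis
    unfolding gderiv_def by (simp add: inner_sum_right)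
qed

text \<open>The weights sum to one, so averaging keeps the constant \<open>K\<close> instead of
  adding the constants up.\<close>

lemma has_lipschitz_gradient_mixture:
  assumes "\<And>w. 0 \<le> \<pi> w" "(\<Sum>w\<in>UNIV. \<pi> w) = 1" "\<And>w. has_lipschitz_gradient K (\<phi> w) (G w)"
  shows "has_lipschitz_gradient K (mixture \<pi> \<phi>) (\<lambda>x. \<Sum>w\<in>UNIV. \<pi> w *\<^sub>R G w x)"
  unfolding has_lipschitz_gradient_def
proof (intro conjI allI gderiv_mixture lipschitz_onI)
  have lip: "\<And>w. K-lipschitz_on UNIV (G w)"
    using assms(3) unfolding has_lipschitz_gradient_def by auto
  show "0 \<le> K"
    using lipschitz_on_nonneg[OF lip] .
  show "GDERIV (\<phi> w) x :> G w x" for w x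
    using assms(3) unfolding has_lipschitz_gradient_def by auto
  fix x y
  have "dist (\<Sum>w\<in>UNIV. \<pi> w *\<^sub>R G w x) (\<Sum>w\<in>UNIV. \<pi> w *\<^sub>R G w y)
      = norm (\<Sum>w\<in>UNIV. \<pi> w *\<^sub>R (G w x - G w y))"
    by (simp add: dist_norm sum_subtractf scaleR_diff_right)
  also have "\<dots> \<le> (\<Sum>w\<in>UNIV. \<pi> w * (K * dist x y))"
    using lipschitz_onD[OF lip, of x y] assms(1)
    by (intro sum_norm_le) (auto intro!: mult_left_mono simp: dist_norm)
  also have "\<dots> = K * dist x y"
    using assms(2) by (simp add: sum_distrib_right[symmetric])
  finally show "dist (\<Sum>w\<in>UNIV. \<pi> w *\<^sub>R G w x) (\<Sum>w\<in>UNIV. \<pi> w *\<^sub>R G w y) \<le> K * dist x y" .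
qed

lemma convex_on_weighted_sum:
  assumes "finite I" "\<And>i. i \<in> I \<Longrightarrow> 0 \<le> \<pi> i" "\<And>i. i \<in> I \<Longrightarrow> convex_on UNIV (\<phi> i)"
  shows "convex_on UNIV (\<lambda>x. \<Sum>i\<in>I. \<pi> i * \<phi> i x)"
  using assms
proof (induction I)
  case (insert i I)
  then show ?case
    by (auto intro!: convex_on_add convex_on_cmul)
qed (simp add: convex_on_const)

lemma strongly_convex_mixture:
  assumes "\<And>w. 0 \<le> \<pi> w" "(\<Sum>w\<in>UNIV. \<pi> w) = 1" "\<And>w. strongly_convex \<mu> (\<phi> w)"
  shows "strongly_convex \<mu> (mixture \<pi> \<phi>)"
proof -
  \<comment> \<open>Unit total weight lets the quadratic be moved inside the average.\<close>
  have "mixture \<pi> \<phi> x - \<mu> / 2 * (norm x)\<^sup>2 = (\<Sum>w\<in>UNIV. \<pi> w * (\<phi> w x - \<mu> / 2 * (norm x)\<^sup>2))" for x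
    using assms(2)
    by (simp add: mixture_def right_diff_distrib sum_subtractf sum_distrib_right[symmetric]
        del: times_divide_eq_right times_divide_eq_left)
  moreover have "convex_on UNIV (\<lambda>x. \<Sum>w\<in>UNIV. \<pi> w * (\<phi> w x - \<mu> / 2 * (norm x)\<^sup>2))"
    using assms unfolding strongly_convex_def
    by (intro convex_on_weighted_sum) auto
  ultimately show ?thesis
    unfolding strongly_convex_def by simp
qed

lemma mixture_mono:
  assumes "\<And>w. 0 \<le> \<pi> w" "\<And>w. \<phi> w x \<le> \<psi> w y"
  shows "mixture \<pi> \<phi> x \<le> mixture \<pi> \<psi> y"
  unfolding mixture_def using assms by (intro sum_mono mult_left_mono) auto

lemma bdd_below_mixture:
  assumes "\<And>w. 0 \<le> \<pi> w" "\<And>w. bdd_below (\<phi> w ` A)"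
  shows "bdd_below (mixture \<pi> \<phi> ` A)"
proof -
  obtain m where m: "\<And>w x. x \<in> A \<Longrightarrow> m w \<le> \<phi> w x"
    using assms(2) unfolding bdd_below_def by (metis imageI)
  then have "mixture \<pi> (\<lambda>w _. m w) x \<le> mixture \<pi> \<phi> x" if "x \<in> A" for x
    using that assms(1) by (intro mixture_mono) auto
  then show ?thesis
    unfolding bdd_below_def by (intro exI[of _ "\<Sum>w\<in>UNIV. \<pi> w * m w"]) (auto simp: mixture_def)
qed

section \<open>Last visits and hitting times\<close>

lemma last_visit_0 [simp]: "last_visit v 0 w = 1"
  by (simp add: last_visit_def)

text \<open>This recursion replaces the maximum in the definition by a case split, which the later
  inductions follow; the default value \<open>1\<close> is carried along until the first
  visit.\<close>

lemma last_visit_Suc: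
  "last_visit v (Suc n) w = (if v (Suc n) = w then Suc n else last_visit v n w)"
proof (cases "v (Suc n) = w")
  case True
  then have "Max {j \<in> {1..Suc n}. v j = w} = Suc n"
    by (intro Max_eqI) auto
  with True show ?thesis
    unfolding last_visit_def by force
next
  case False
  then have "{j \<in> {1..Suc n}. v j = w} = {j \<in> {1..n}. v j = w}"
    by (auto simp: le_Suc_eq)
  moreover have "(\<exists>j\<in>{1..Suc n}. v j = w) \<longleftrightarrow> (\<exists>j\<in>{1..n}. v j = w)"
    using False by (auto simp: le_Suc_eq)
  ultimately show ?thesis
    using False unfolding last_visit_def by simp
qed

lemma last_visit_ge_1: "1 \<le> last_visit v n w"
  by (induction n) (auto simp: last_visit_Suc)

lemma last_visit_le:
  assumes "1 \<le> n"
  shows "last_visit v n w \<le> n"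
  using assms by (induction n rule: nat_induct_at_least) (auto simp: last_visit_Suc)

lemma le_last_visit:
  assumes "1 \<le> j" "j \<le> n" "v j = w"
  shows "j \<le> last_visit v n w"
  using assms(2,1,3) by (induction n rule: dec_induct) (cases j, auto simp: last_visit_Suc)

text \<open>Once \<open>w\<close> is visited at time \<open>i + j\<close>, its last visit lies
  beyond \<open>i\<close>, so only the \<open>j\<close> times in \<open>{i..<i + j}\<close> can be
  counted. Without a later visit the hitting time is infinite.\<close>

lemma card_last_visit_le_hit_time:
  "of_nat (card {n \<in> {i..N}. last_visit v n w \<le> i}) \<le> hit_time v i w"
  unfolding hit_time_def
proof (intro INF_greatest)
  fix j assume j: "j \<in> {j. 1 \<le> j \<and> v (i + j) = w}"
  have "{n \<in> {i..N}. last_visit v n w \<le> i} \<subseteq> {i..<i + j}"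
  proof
    fix n assume n: "n \<in> {n \<in> {i..N}. last_visit v n w \<le> i}"
    have "\<not> i + j \<le> n"
      using j n le_last_visit[of "i + j" n v w] by auto
    with n show "n \<in> {i..<i + j}"
      by simp
  qed
  then have "card {n \<in> {i..N}. last_visit v n w \<le> i} \<le> j"
    using card_mono[of "{i..<i + j}"] by fastforce
  then show "of_nat (card {n \<in> {i..N}. last_visit v n w \<le> i}) \<le> (of_nat j :: ennreal)"
    by simp
qed

text \<open>Exchanging the sums, \<open>a i\<close> is counted once for every
  \<open>n \<ge> i\<close> at which \<open>w\<close> has not been visited since time
  \<open>i\<close>; the preceding count applies.\<close>

lemma sum_since_last_visit_le_hit_time:
  assumes a: "\<And>i. 0 \<le> a i"
  shows "ennreal (\<Sum>n=1..N. \<Sum>i=last_visit v n w..n. a i) \<le> (\<Sum>i=1..N. ennreal (a i) * hit_time v i w)"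
proof -
  have "(\<Sum>n=1..N. \<Sum>i=last_visit v n w..n. a i)
      = (\<Sum>n=1..N. \<Sum>i=1..N. if last_visit v n w \<le> i \<and> i \<le> n then a i else 0)"
  proof (rule sum.cong[OF refl])
    fix n assume "n \<in> {1..N}"
    then have "{last_visit v n w..n} = {i \<in> {1..N}. last_visit v n w \<le> i \<and> i \<le> n}"
      using last_visit_ge_1[of v n w] by auto
    then show "(\<Sum>i=last_visit v n w..n. a i)
        = (\<Sum>i=1..N. if last_visit v n w \<le> i \<and> i \<le> n then a i else 0)"
      by (simp add: sum.inter_filter[symmetric])
  qed
  also have "\<dots> = (\<Sum>i=1..N. \<Sum>n=1..N. if last_visit v n w \<le> i \<and> i \<le> n then a i else 0)"
    by (rule sum.swap)
  also have "\<dots> = (\<Sum>i=1..N. a i * card {n \<in> {i..N}. last_visit v n w \<le> i})"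
  proof (rule sum.cong[OF refl])
    fix i assume "i \<in> {1..N}"
    then have "{n \<in> {1..N}. last_visit v n w \<le> i \<and> i \<le> n} = {n \<in> {i..N}. last_visit v n w \<le> i}"
      by auto
    then show "(\<Sum>n=1..N. if last_visit v n w \<le> i \<and> i \<le> n then a i else 0)
        = a i * card {n \<in> {i..N}. last_visit v n w \<le> i}"
      by (simp add: sum.inter_filter[symmetric] mult.commute)
  qed
  also have "ennreal \<dots> = (\<Sum>i=1..N. ennreal (a i) * of_nat (card {n \<in> {i..N}. last_visit v n w \<le> i}))"
    using a by (simp add: sum_ennreal[symmetric] ennreal_mult ennreal_of_nat_eq_real_of_nat)
  also have "\<dots> \<le> (\<Sum>i=1..N. ennreal (a i) * hit_time v i w)"
    by (intro sum_mono mult_left_mono card_last_visit_le_hit_time) simp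
  finally show ?thesis .
qed

text \<open>Triangle inequality. The path starts at index \<open>k - 1\<close> because a surrogate
  refreshed at time \<open>k\<close> is built at the previous iterate.\<close>

lemma norm_diff_le_sum_increments:
  fixes \<theta> :: "nat \<Rightarrow> 'a::real_normed_vector"
  assumes "1 \<le> k" "k \<le> n"
  shows "norm (\<theta> n - \<theta> (k - 1)) \<le> (\<Sum>i=k..n. norm (\<theta> i - \<theta> (i - 1)))"
  using assms(2)
proof (induction n rule: dec_induct)
  case (step n)
  have "norm (\<theta> (Suc n) - \<theta> (k - 1)) \<le> norm (\<theta> (Suc n) - \<theta> n) + norm (\<theta> n - \<theta> (k - 1))"
    using norm_triangle_ineq[of "\<theta> (Suc n) - \<theta> n" "\<theta> n - \<theta> (k - 1)"] by simp
  with step show ?case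
    by (simp add: sum.nat_ivl_Suc')
qed simp

section \<open>Pathwise bounds\<close>

text \<open>The default value \<open>1\<close> of \<open>last_visit\<close> fits exactly: before the
  first visit to \<open>w\<close> the base point is \<open>\<theta> (1 - 1)\<close>, where the
  initial surrogate was taken.\<close>

lemma surrogate_at_last_visit:
  assumes "surrogate_updates S f v \<theta> g"
  shows "g n w \<in> S (f w) (\<theta> (last_visit v n w - 1))"
proof (induction n)
  case 0
  then show ?case
    using assms by (simp add: surrogate_updates_def)
next
  case (Suc n)
  have "g (Suc n) (v (Suc n)) \<in> S (f (v (Suc n))) (\<theta> (Suc n - 1))"
      "w \<noteq> v (Suc n) \<Longrightarrow> g (Suc n) w = g (Suc n - 1) w"
    using assms unfolding surrogate_updates_def by auto
  with Suc show ?case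
    by (auto simp: last_visit_Suc)
qed

lemma surrogates_majorize:
  assumes "g \<in> surrogates \<Theta> L \<phi> x" "y \<in> \<Theta>"
  shows "\<phi> y \<le> g y"
  using assms unfolding surrogates_def by blast

lemma surrogates_touch:
  assumes "g \<in> surrogates \<Theta> L \<phi> x"
  shows "g x = \<phi> x"
  using assms unfolding surrogates_def by simp

lemma strong_surrogates_subset: "strong_surrogates \<Theta> L \<mu> \<phi> x \<subseteq> surrogates \<Theta> L \<phi> x"
  unfolding strong_surrogates_def by auto

text \<open>The lemmas of this locale concern a single sample path; randomness enters only with
  \<open>sampled_process\<close>.\<close>

locale finite_sum_problem =
  fixes \<Theta> :: "'a::euclidean_space set" and \<pi> :: "'v::finite \<Rightarrow> real"
    and f :: "'v \<Rightarrow> 'a \<Rightarrow> real" and L :: real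
  assumes weight_nonneg: "\<And>w. 0 \<le> \<pi> w" and weight_sum: "(\<Sum>w\<in>UNIV. \<pi> w) = 1"
    and convex_domain: "convex \<Theta>"
    and bounded_below: "\<And>w. bdd_below (f w ` \<Theta>)"
    and dir_deriv_exists: "\<And>w x y. x \<in> \<Theta> \<Longrightarrow> y \<in> \<Theta> \<Longrightarrow> \<exists>l. has_dir_deriv (f w) x (y - x) l"
    and L_pos: "0 < L"
begin

lemma surrogate_gradient_bound:
  assumes "\<phi> \<in> surrogates \<Theta> L \<psi> x"
  shows "\<exists>G. has_lipschitz_gradient L (\<lambda>y. \<phi> y - \<psi> y) G \<and> (\<forall>y. norm (G y) \<le> L * norm (y - x))"
proof -
  obtain G where G: "has_lipschitz_gradient L (\<lambda>y. \<phi> y - \<psi> y) G" "G x = 0"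
    using assms unfolding surrogates_def by auto
  have "norm (G y) \<le> L * norm (y - x)" for y
    using G lipschitz_onD[of L UNIV G y x] by (auto simp: has_lipschitz_gradient_def dist_norm)
  with G show ?thesis by auto
qed

text \<open>Each error \<open>g w - f w\<close> has an \<open>L\<close>-Lipschitz gradient vanishing
  at \<open>c w\<close>. Hence the averaged error is smooth even where \<open>f\<close> is not, with
  a small gradient near the base points.\<close>

lemma mixture_error_gradient:
  assumes "\<And>w. g w \<in> surrogates \<Theta> L (f w) (c w)"
  shows "\<exists>H. has_lipschitz_gradient L (\<lambda>y. mixture \<pi> g y - mixture \<pi> f y) H \<and>
    (\<forall>y. norm (H y) \<le> L * (\<Sum>w\<in>UNIV. \<pi> w * norm (y - c w)))"
proof -
  obtain G where G: "\<And>w. has_lipschitz_gradient L (\<lambda>y. g w y - f w y) (G w)"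
    "\<And>w y. norm (G w y) \<le> L * norm (y - c w)"
    using surrogate_gradient_bound[OF assms] by metis
  let ?H = "\<lambda>x. \<Sum>w\<in>UNIV. \<pi> w *\<^sub>R G w x"
  have "has_lipschitz_gradient L (mixture \<pi> (\<lambda>w y. g w y - f w y)) ?H"
    by (intro has_lipschitz_gradient_mixture weight_nonneg weight_sum G)
  moreover have "mixture \<pi> (\<lambda>w y. g w y - f w y) = (\<lambda>y. mixture \<pi> g y - mixture \<pi> f y)"
    by (simp add: mixture_def fun_eq_iff right_diff_distrib sum_subtractf)
  moreover have "norm (?H y) \<le> L * (\<Sum>w\<in>UNIV. \<pi> w * norm (y - c w))" for y
  proof -
    have "norm (?H y) \<le> (\<Sum>w\<in>UNIV. \<pi> w * (L * norm (y - c w)))"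
      using G(2) weight_nonneg by (intro sum_norm_le) (auto intro!: mult_left_mono)
    then show ?thesis
      by (simp add: sum_distrib_left mult.left_commute)
  qed
  ultimately show ?thesis by auto
qed

lemma surrogate_member:
  assumes S: "\<And>\<phi> x. S \<phi> x \<subseteq> surrogates \<Theta> L \<phi> x" and upd: "surrogate_updates S f v \<theta> g"
  shows "g n w \<in> surrogates \<Theta> L (f w) (\<theta> (last_visit v n w - 1))"
  using subsetD[OF S surrogate_at_last_visit[OF upd]] .

text \<open>Only the surrogate of \<open>v (Suc n)\<close> changes, and the new one touches its
  target at \<open>\<theta> n\<close>, where the old one majorizes it.\<close>

lemma mixture_update_le:
  assumes S: "\<And>\<phi> x. S \<phi> x \<subseteq> surrogates \<Theta> L \<phi> x" and upd: "surrogate_updates S f v \<theta> g"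
    and "\<theta> n \<in> \<Theta>"
  shows "mixture \<pi> (g (Suc n)) (\<theta> n) \<le> mixture \<pi> (g n) (\<theta> n)"
proof (rule mixture_mono[OF weight_nonneg])
  fix w
  have "f w (\<theta> n) \<le> g n w (\<theta> n)"
    by (rule surrogates_majorize[OF surrogate_member[OF S upd] assms(3)])
  moreover have "g (Suc n) w (\<theta> n) = f w (\<theta> n)" if "w = v (Suc n)"
    using surrogates_touch[OF surrogate_member[OF S upd, of "Suc n" w]] that
    by (simp add: last_visit_Suc)
  moreover have "g (Suc n) w = g n w" if "w \<noteq> v (Suc n)"
    using upd that unfolding surrogate_updates_def by (auto dest: spec[of _ "Suc n"])
  ultimately show "g (Suc n) w (\<theta> n) \<le> g n w (\<theta> n)"
    by (cases "w = v (Suc n)") auto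
qed

text \<open>\<open>bounded_below\<close> makes the real infimum a genuine lower bound, which
  majorization passes on to the surrogates; it closes the telescoping sums.\<close>

lemma Inf_le_mixture_surrogate:
  assumes S: "\<And>\<phi> x. S \<phi> x \<subseteq> surrogates \<Theta> L \<phi> x" and upd: "surrogate_updates S f v \<theta> g"
    and "x \<in> \<Theta>"
  shows "(INF x\<in>\<Theta>. mixture \<pi> f x) \<le> mixture \<pi> (g n) x"
proof -
  have "(INF x\<in>\<Theta>. mixture \<pi> f x) \<le> mixture \<pi> f x"
    by (intro cINF_lower bdd_below_mixture weight_nonneg bounded_below assms)
  also have "\<dots> \<le> mixture \<pi> (g n) x"
    by (intro mixture_mono weight_nonneg surrogates_majorize[OF surrogate_member[OF S upd] assms(3)])
  finally show ?thesis .
qed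

lemma error_gradient_at:
  assumes S: "\<And>\<phi> x. S \<phi> x \<subseteq> surrogates \<Theta> L \<phi> x" and upd: "surrogate_updates S f v \<theta> g"
  shows "\<exists>H. has_lipschitz_gradient L (\<lambda>y. mixture \<pi> (g n) y - mixture \<pi> f y) H \<and>
    (\<forall>y. norm (H y) \<le> L * (\<Sum>w\<in>UNIV. \<pi> w * norm (y - \<theta> (last_visit v n w - 1))))"
  by (intro mixture_error_gradient surrogate_member[OF S upd])

text \<open>The right-hand side is grouped so that the inner sum is the \<open>\<pi>\<close>-average
  of hitting times whose conditional version defines \<open>t_odot\<close>.\<close>

lemma weighted_sum_since_last_visit_le:
  assumes a: "\<And>i. 0 \<le> a i"
  shows "ennreal (\<Sum>n=1..N. L * (\<Sum>w\<in>UNIV. \<pi> w * (\<Sum>i=last_visit v n w..n. a i)))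
    \<le> ennreal L * (\<Sum>i=1..N. ennreal (a i) * (\<Sum>w\<in>UNIV. hit_time v i w * ennreal (\<pi> w)))"
proof -
  have "(\<Sum>n=1..N. L * (\<Sum>w\<in>UNIV. \<pi> w * (\<Sum>i=last_visit v n w..n. a i)))
      = L * (\<Sum>w\<in>UNIV. \<pi> w * (\<Sum>n=1..N. \<Sum>i=last_visit v n w..n. a i))"
    unfolding sum_distrib_left by (rule sum.swap)
  also have "ennreal \<dots> = ennreal L * (\<Sum>w\<in>UNIV. ennreal (\<pi> w) * ennreal (\<Sum>n=1..N. \<Sum>i=last_visit v n w..n. a i))"
    using L_pos a weight_nonneg by (simp add: ennreal_mult sum_nonneg sum_ennreal[symmetric] del: sum_ennreal)
  also have "\<dots> \<le> ennreal L * (\<Sum>w\<in>UNIV. ennreal (\<pi> w) * (\<Sum>i=1..N. ennreal (a i) * hit_time v i w))"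
    by (intro mult_left_mono sum_mono sum_since_last_visit_le_hit_time a) auto
  also have "(\<Sum>w\<in>UNIV. ennreal (\<pi> w) * (\<Sum>i=1..N. ennreal (a i) * hit_time v i w))
      = (\<Sum>i=1..N. ennreal (a i) * (\<Sum>w\<in>UNIV. hit_time v i w * ennreal (\<pi> w)))"
    unfolding sum_distrib_left by (subst sum.swap) (simp add: ac_simps)
  finally show ?thesis .
qed

section \<open>Algorithm 1 on one sample path\<close>

lemma algorithm1_in_domain:
  assumes "algorithm1 \<Theta> \<pi> f L \<mu> reg v \<theta> g"
  shows "\<theta> n \<in> \<Theta>"
  using assms unfolding algorithm1_def is_arg_min_linorder by (cases n) auto

text \<open>Half of \<open>reg v (Suc n)\<close> comes from the proximal term at the new iterate;
  the other half, with \<open>\<mu> / 2\<close>, comes from quadratic growth of the regularized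
  objective. Refreshing the surrogate only lowers the value at \<open>\<theta> n\<close>.\<close>

lemma algorithm1_step_decrease:
  assumes alg: "algorithm1 \<Theta> \<pi> f L \<mu> reg v \<theta> g"
  shows "mixture \<pi> (g (Suc n)) (\<theta> (Suc n)) + (reg v (Suc n) + \<mu> / 2) * (norm (\<theta> (Suc n) - \<theta> n))\<^sup>2
    \<le> mixture \<pi> (g n) (\<theta> n)"
proof -
  let ?\<rho> = "reg v (Suc n)"
  have upd: "surrogate_updates (strong_surrogates \<Theta> L \<mu>) f v \<theta> g"
    using alg unfolding algorithm1_def by simp
  have "strongly_convex \<mu> (g (Suc n) w)" for w
    using surrogate_at_last_visit[OF upd, of "Suc n" w] unfolding strong_surrogates_def by simp
  then have "strongly_convex (\<mu> + ?\<rho>) (\<lambda>x. mixture \<pi> (g (Suc n)) x + ?\<rho> / 2 * (norm (x - \<theta> n))\<^sup>2)"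
    by (intro strongly_convex_proximal strongly_convex_mixture weight_nonneg weight_sum)
  moreover have "is_arg_min (\<lambda>x. mixture \<pi> (g (Suc n)) x + ?\<rho> / 2 * (norm (x - \<theta> n))\<^sup>2)
      (\<lambda>x. x \<in> \<Theta>) (\<theta> (Suc n))"
    using alg unfolding algorithm1_def by (auto dest: spec[of _ "Suc n"])
  ultimately have "mixture \<pi> (g (Suc n)) (\<theta> (Suc n)) + ?\<rho> / 2 * (norm (\<theta> (Suc n) - \<theta> n))\<^sup>2
      + (\<mu> + ?\<rho>) / 2 * (norm (\<theta> (Suc n) - \<theta> n))\<^sup>2
      \<le> mixture \<pi> (g (Suc n)) (\<theta> n) + ?\<rho> / 2 * (norm (\<theta> n - \<theta> n))\<^sup>2"
    using algorithm1_in_domain[OF alg] convex_domain by (intro strongly_convex_argmin)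
  moreover have "mixture \<pi> (g (Suc n)) (\<theta> n) \<le> mixture \<pi> (g n) (\<theta> n)"
    using mixture_update_le[OF strong_surrogates_subset upd algorithm1_in_domain[OF alg]] .
  ultimately show ?thesis
    by (simp add: field_simps)
qed

lemma algorithm1_sum_increments:
  assumes alg: "algorithm1 \<Theta> \<pi> f L \<mu> reg v \<theta> g"
  shows "(\<Sum>n=1..N. (reg v n + \<mu> / 2) * (norm (\<theta> n - \<theta> (n - 1)))\<^sup>2) \<le> initial_gap \<Theta> \<pi> f (g 0) (\<theta> 0)"
proof -
  have "mixture \<pi> (g N) (\<theta> N) + (\<Sum>n=1..N. (reg v n + \<mu> / 2) * (norm (\<theta> n - \<theta> (n - 1)))\<^sup>2)
      \<le> mixture \<pi> (g 0) (\<theta> 0)"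
  proof (induction N)
    case (Suc N)
    then show ?case
      using algorithm1_step_decrease[OF alg, of N] by simp
  qed simp
  moreover have "(INF x\<in>\<Theta>. mixture \<pi> f x) \<le> mixture \<pi> (g N) (\<theta> N)"
    using alg algorithm1_in_domain[OF alg] unfolding algorithm1_def
    by (intro Inf_le_mixture_surrogate[OF strong_surrogates_subset]) auto
  ultimately show ?thesis
    unfolding initial_gap_def by simp
qed

text \<open>The regularized objective has nonnegative directional derivative at its minimizer. What
  separates it from \<open>mixture \<pi> f\<close>, namely error and proximal term, has a gradient,
  whose norm bounds the gap along directions of norm at most one.\<close>

lemma algorithm1_gap_le:
  assumes alg: "algorithm1 \<Theta> \<pi> f L \<mu> reg v \<theta> g" and n: "1 \<le> n" and reg: "0 \<le> reg v n"
  shows "e2ennreal (opt_gap \<Theta> (mixture \<pi> f) (\<theta> n)) \<le>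
    ennreal (L * (\<Sum>w\<in>UNIV. \<pi> w * (\<Sum>i=last_visit v n w..n. norm (\<theta> i - \<theta> (i - 1))))
      + reg v n * norm (\<theta> n - \<theta> (n - 1)))"
proof (rule opt_gap_le)
  fix y assume y: "y \<in> \<Theta>" "norm (y - \<theta> n) \<le> 1"
  let ?x = "\<theta> n" and ?c = "\<theta> (n - 1)"
  have upd: "surrogate_updates (strong_surrogates \<Theta> L \<mu>) f v \<theta> g"
    using alg unfolding algorithm1_def by simp
  obtain H where H: "has_lipschitz_gradient L (\<lambda>y. mixture \<pi> (g n) y - mixture \<pi> f y) H"
    and H_le: "\<And>y. norm (H y) \<le> L * (\<Sum>w\<in>UNIV. \<pi> w * norm (y - \<theta> (last_visit v n w - 1)))"
    using error_gradient_at[OF strong_surrogates_subset upd, of n] by blast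
  have "\<exists>l. has_dir_deriv (f w) ?x (y - ?x) l" for w
    using dir_deriv_exists algorithm1_in_domain[OF alg] y by blast
  then obtain l where l: "\<And>w. has_dir_deriv (f w) ?x (y - ?x) (l w)"
    by metis
  let ?l = "\<Sum>w\<in>UNIV. \<pi> w * l w"
  have f_l: "has_dir_deriv (mixture \<pi> f) ?x (y - ?x) ?l"
    by (rule has_dir_deriv_mixture[OF l])
  \<comment> \<open>The averaged surrogate is split into \<open>mixture \<pi> f\<close>, whose
    directional derivatives are assumed to exist, and the error, which is differentiable.\<close>
  have "has_dir_deriv (\<lambda>x. mixture \<pi> f x + (mixture \<pi> (g n) x - mixture \<pi> f x)
      + reg v n / 2 * (norm (x - ?c))\<^sup>2) ?x (y - ?x)
      (?l + inner (y - ?x) (H ?x) + inner (y - ?x) (reg v n *\<^sub>R (?x - ?c)))"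
    using H f_l unfolding has_lipschitz_gradient_def
    by (intro has_dir_deriv_add has_dir_deriv_gderiv gderiv_proximal_term) auto
  moreover have "is_arg_min (\<lambda>x. mixture \<pi> f x + (mixture \<pi> (g n) x - mixture \<pi> f x)
      + reg v n / 2 * (norm (x - ?c))\<^sup>2) (\<lambda>x. x \<in> \<Theta>) ?x"
    using alg n unfolding algorithm1_def by simp
  ultimately have "0 \<le> ?l + inner (y - ?x) (H ?x) + inner (y - ?x) (reg v n *\<^sub>R (?x - ?c))"
    using argmin_dir_deriv_nonneg[OF _ convex_domain y(1)] by blast
  moreover have "inner (y - ?x) z \<le> norm z" for z
    using norm_cauchy_schwarz[of "y - ?x" z] y(2) mult_right_mono[of "norm (y - ?x)" 1 "norm z"] by simp
  note this[of "H ?x"] this[of "reg v n *\<^sub>R (?x - ?c)"]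
  ultimately have "- dir_deriv (mixture \<pi> f) ?x (y - ?x) \<le> norm (H ?x) + norm (reg v n *\<^sub>R (?x - ?c))"
    unfolding dir_deriv_eqI[OF f_l] by linarith
  also have "norm (H ?x) \<le> L * (\<Sum>w\<in>UNIV. \<pi> w * norm (?x - \<theta> (last_visit v n w - 1)))"
    by (rule H_le)
  also have "\<dots> \<le> L * (\<Sum>w\<in>UNIV. \<pi> w * (\<Sum>i=last_visit v n w..n. norm (\<theta> i - \<theta> (i - 1))))"
    using L_pos by (intro mult_left_mono sum_mono norm_diff_le_sum_increments weight_nonneg
        last_visit_ge_1 last_visit_le n) auto
  finally show "- dir_deriv (mixture \<pi> f) ?x (y - ?x) \<le>
      L * (\<Sum>w\<in>UNIV. \<pi> w * (\<Sum>i=last_visit v n w..n. norm (\<theta> i - \<theta> (i - 1))))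
      + reg v n * norm (\<theta> n - \<theta> (n - 1))"
    using reg by simp
qed

lemma algorithm1_sum_gap_le:
  assumes alg: "algorithm1 \<Theta> \<pi> f L \<mu> reg v \<theta> g" and reg: "\<And>n. 1 \<le> n \<Longrightarrow> 0 \<le> reg v n"
  shows "(\<Sum>n=1..N. e2ennreal (opt_gap \<Theta> (mixture \<pi> f) (\<theta> n))) \<le>
    ennreal (\<Sum>n=1..N. reg v n * norm (\<theta> n - \<theta> (n - 1))) +
    ennreal L * (\<Sum>i=1..N. ennreal (norm (\<theta> i - \<theta> (i - 1))) *
      (\<Sum>w\<in>UNIV. hit_time v i w * ennreal (\<pi> w)))"
proof -
  let ?A = "\<lambda>n. L * (\<Sum>w\<in>UNIV. \<pi> w * (\<Sum>i=last_visit v n w..n. norm (\<theta> i - \<theta> (i - 1))))"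
  let ?B = "\<lambda>n. reg v n * norm (\<theta> n - \<theta> (n - 1))"
  have A: "0 \<le> ?A n" for n
    using L_pos weight_nonneg by (intro mult_nonneg_nonneg sum_nonneg) auto
  have "(\<Sum>n=1..N. e2ennreal (opt_gap \<Theta> (mixture \<pi> f) (\<theta> n))) \<le> (\<Sum>n=1..N. ennreal (?A n + ?B n))"
    using reg by (intro sum_mono algorithm1_gap_le[OF alg]) auto
  also have "\<dots> = (\<Sum>n=1..N. ennreal (?B n)) + (\<Sum>n=1..N. ennreal (?A n))"
    using A reg unfolding sum.distrib[symmetric]
    by (intro sum.cong) (auto simp: ennreal_plus add.commute)
  also have "\<dots> = ennreal (\<Sum>n=1..N. ?B n) + ennreal (\<Sum>n=1..N. ?A n)"
    using A reg by (subst (1 2) sum_ennreal) auto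
  also have "ennreal (\<Sum>n=1..N. ?A n) \<le> ennreal L * (\<Sum>i=1..N. ennreal (norm (\<theta> i - \<theta> (i - 1))) *
      (\<Sum>w\<in>UNIV. hit_time v i w * ennreal (\<pi> w)))"
    by (rule weighted_sum_since_last_visit_le) simp
  finally show ?thesis
    by (simp add: add_left_mono)
qed

section \<open>Algorithm 2 on one sample path\<close>

lemma algorithm2_in_domain:
  assumes "algorithm2 \<Theta> \<pi> f L r v \<theta> g"
  shows "\<theta> n \<in> \<Theta>"
  using assms unfolding algorithm2_def is_arg_min_linorder by (cases n) auto

lemma algorithm2_increment_le:
  assumes "algorithm2 \<Theta> \<pi> f L r v \<theta> g" "1 \<le> n"
  shows "norm (\<theta> n - \<theta> (n - 1)) \<le> r n"
  using assms unfolding algorithm2_def is_arg_min_linorder by (auto simp: dist_norm norm_minus_commute)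

lemma algorithm2_argmin:
  assumes "algorithm2 \<Theta> \<pi> f L r v \<theta> g" "z \<in> \<Theta>" "norm (z - \<theta> n) \<le> r (Suc n)"
  shows "mixture \<pi> (g (Suc n)) (\<theta> (Suc n)) \<le> mixture \<pi> (g (Suc n)) z"
proof -
  have "is_arg_min (mixture \<pi> (g (Suc n))) (\<lambda>x. x \<in> \<Theta> \<inter> cball (\<theta> n) (r (Suc n))) (\<theta> (Suc n))"
    using assms(1) unfolding algorithm2_def by (auto dest: spec[of _ "Suc n"])
  with assms(2,3) show ?thesis
    unfolding is_arg_min_linorder by (auto simp: dist_norm norm_minus_commute)
qed

lemma algorithm2_step_decrease:
  assumes alg: "algorithm2 \<Theta> \<pi> f L r v \<theta> g" and r: "0 \<le> r (Suc n)"
  shows "mixture \<pi> (g (Suc n)) (\<theta> (Suc n)) \<le> mixture \<pi> (g n) (\<theta> n)"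
proof -
  have "mixture \<pi> (g (Suc n)) (\<theta> (Suc n)) \<le> mixture \<pi> (g (Suc n)) (\<theta> n)"
    using r by (intro algorithm2_argmin[OF alg] algorithm2_in_domain[OF alg]) simp
  also have "\<dots> \<le> mixture \<pi> (g n) (\<theta> n)"
    using alg algorithm2_in_domain[OF alg] unfolding algorithm2_def
    by (intro mixture_update_le[of "surrogates \<Theta> L"]) auto
  finally show ?thesis .
qed

text \<open>The competitor at fraction \<open>b = min 1 (r (Suc n))\<close> of the way from
  \<open>\<theta> n\<close> to \<open>y\<close> lies in \<open>\<Theta>\<close> by convexity and in
  the next ball. Minimality of \<open>\<theta> (Suc n)\<close> bounds \<open>b\<close> times the
  slope at \<open>\<theta> n\<close> by the decrease of the surrogate values plus error
  terms.\<close>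

lemma algorithm2_gap_le:
  assumes alg: "algorithm2 \<Theta> \<pi> f L r v \<theta> g"
    and smooth: "\<And>w. has_lipschitz_gradient L (f w) (F w)"
    and r: "\<And>n. 1 \<le> n \<Longrightarrow> 0 < r n \<and> r (Suc n) \<le> r n" and n: "1 \<le> n"
  shows "ennreal (min 1 (r (Suc n))) * e2ennreal (opt_gap \<Theta> (mixture \<pi> f) (\<theta> n)) \<le>
    ennreal (mixture \<pi> (g n) (\<theta> n) - mixture \<pi> (g (Suc n)) (\<theta> (Suc n)) + L * (r (Suc n))\<^sup>2
      + L * (\<Sum>w\<in>UNIV. \<pi> w * (\<Sum>i=last_visit v n w..n. (r i)\<^sup>2)))"
proof -
  let ?x = "\<theta> n" and ?G = "\<lambda>n. mixture \<pi> (g n)"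
  define b where "b = min 1 (r (Suc n))"
  define X where "X = ?G n ?x - ?G (Suc n) (\<theta> (Suc n)) + L * (r (Suc n))\<^sup>2
      + L * (\<Sum>w\<in>UNIV. \<pi> w * (\<Sum>i=last_visit v n w..n. (r i)\<^sup>2))"
  have b: "0 < b" "b \<le> 1" "b \<le> r (Suc n)"
    using r[of "Suc n"] unfolding b_def by auto
  have upd: "surrogate_updates (surrogates \<Theta> L) f v \<theta> g"
    using alg unfolding algorithm2_def by simp
  obtain H where H: "has_lipschitz_gradient L (\<lambda>y. ?G (Suc n) y - mixture \<pi> f y) H"
    and H_le: "\<And>y. norm (H y) \<le> L * (\<Sum>w\<in>UNIV. \<pi> w * norm (y - \<theta> (last_visit v (Suc n) w - 1)))"
    using error_gradient_at[of "surrogates \<Theta> L", OF subset_refl upd, of "Suc n"] by blast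
  define D where "D = (\<lambda>x. \<Sum>w\<in>UNIV. \<pi> w *\<^sub>R F w x)"
  have D: "has_lipschitz_gradient L (mixture \<pi> f) D"
    unfolding D_def by (intro has_lipschitz_gradient_mixture weight_nonneg weight_sum smooth)
  have r_le: "r (Suc n) \<le> r i" if "1 \<le> i" "i \<le> Suc n" for i
    using that(2,1)
  proof (induction i rule: inc_induct)
    case (step i)
    then show ?case using r[of i] by force
  qed simp
  \<comment> \<open>The surrogate of \<open>v (Suc n)\<close> was just built at \<open>?x\<close>
    and contributes nothing. For any other \<open>w\<close> the increment at time \<open>i\<close>
    is at most \<open>r i\<close>, and so is \<open>b\<close> by monotonicity of the radii; hence
    the squares.\<close>
  have H_x: "b * norm (H ?x) \<le> L * (\<Sum>w\<in>UNIV. \<pi> w * (\<Sum>i=last_visit v n w..n. (r i)\<^sup>2))"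
  proof -
    have "b * norm (?x - \<theta> (last_visit v (Suc n) w - 1)) \<le> (\<Sum>i=last_visit v n w..n. (r i)\<^sup>2)" for w
    proof (cases "v (Suc n) = w")
      case False
      have "norm (?x - \<theta> (last_visit v n w - 1)) \<le> (\<Sum>i=last_visit v n w..n. norm (\<theta> i - \<theta> (i - 1)))"
        by (intro norm_diff_le_sum_increments last_visit_ge_1 last_visit_le n)
      then have "b * norm (?x - \<theta> (last_visit v n w - 1))
          \<le> b * (\<Sum>i=last_visit v n w..n. norm (\<theta> i - \<theta> (i - 1)))"
        using b by (intro mult_left_mono) auto
      also have "\<dots> \<le> (\<Sum>i=last_visit v n w..n. (r i)\<^sup>2)"
        unfolding sum_distrib_left
      proof (rule sum_mono)
        fix i assume "i \<in> {last_visit v n w..n}"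
        then have i: "1 \<le> i" "i \<le> n"
          using last_visit_ge_1[of v n w] by auto
        have "b * norm (\<theta> i - \<theta> (i - 1)) \<le> r i * r i"
          using b r_le[of i] i algorithm2_increment_le[OF alg, of i] by (intro mult_mono) auto
        then show "b * norm (\<theta> i - \<theta> (i - 1)) \<le> (r i)\<^sup>2"
          by (simp add: power2_eq_square)
      qed
      finally show ?thesis
        using False by (simp add: last_visit_Suc)
    qed (simp add: last_visit_Suc sum_nonneg)
    then have "L * (\<Sum>w\<in>UNIV. \<pi> w * (b * norm (?x - \<theta> (last_visit v (Suc n) w - 1))))
        \<le> L * (\<Sum>w\<in>UNIV. \<pi> w * (\<Sum>i=last_visit v n w..n. (r i)\<^sup>2))"
      using L_pos weight_nonneg by (intro mult_left_mono sum_mono) auto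
    moreover have "b * norm (H ?x) \<le> b * (L * (\<Sum>w\<in>UNIV. \<pi> w * norm (?x - \<theta> (last_visit v (Suc n) w - 1))))"
      using b H_le by (intro mult_left_mono) auto
    ultimately show ?thesis
      by (simp add: sum_distrib_left mult.left_commute)
  qed
  have "e2ennreal (opt_gap \<Theta> (mixture \<pi> f) ?x) \<le> ennreal (X / b)"
  proof (rule opt_gap_le)
    fix y assume y: "y \<in> \<Theta>" "norm (y - ?x) \<le> 1"
    let ?d = "y - ?x"
    have z: "?x + b *\<^sub>R ?d \<in> \<Theta>"
    proof -
      have "?x + b *\<^sub>R ?d = (1 - b) *\<^sub>R ?x + b *\<^sub>R y"
        by (simp add: algebra_simps)
      also have "\<dots> \<in> \<Theta>"
        using b by (intro convexD convex_domain algorithm2_in_domain[OF alg] y) auto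
      finally show ?thesis .
    qed
    have bd: "(norm (b *\<^sub>R ?d))\<^sup>2 \<le> (r (Suc n))\<^sup>2" "norm (b *\<^sub>R ?d) \<le> r (Suc n)"
    proof -
      have "norm (b *\<^sub>R ?d) \<le> b * 1"
        using b y(2) unfolding norm_scaleR by (intro mult_mono) auto
      then show "norm (b *\<^sub>R ?d) \<le> r (Suc n)"
        using b by linarith
      then show "(norm (b *\<^sub>R ?d))\<^sup>2 \<le> (r (Suc n))\<^sup>2"
        by (intro power_mono) auto
    qed
    have "?G (Suc n) (\<theta> (Suc n)) \<le> ?G (Suc n) (?x + b *\<^sub>R ?d)"
      using bd by (intro algorithm2_argmin[OF alg z]) simp
    also have "\<dots> = mixture \<pi> f (?x + b *\<^sub>R ?d) + (?G (Suc n) (?x + b *\<^sub>R ?d) - mixture \<pi> f (?x + b *\<^sub>R ?d))"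
      by simp
    \<comment> \<open>The quadratic bound is applied twice, to \<open>mixture \<pi> f\<close> and to
      the error; the two halves add up to the full constant \<open>L\<close>.\<close>
    also have "\<dots> \<le> (mixture \<pi> f ?x + inner (b *\<^sub>R ?d) (D ?x) + L / 2 * (norm (b *\<^sub>R ?d))\<^sup>2)
        + (?G (Suc n) ?x - mixture \<pi> f ?x + inner (b *\<^sub>R ?d) (H ?x) + L / 2 * (norm (b *\<^sub>R ?d))\<^sup>2)"
      by (intro add_mono smooth_upper_bound D H)
    also have "\<dots> = ?G (Suc n) ?x + b * inner ?d (D ?x) + b * inner ?d (H ?x) + L * (norm (b *\<^sub>R ?d))\<^sup>2"
      by (simp add: algebra_simps)
    also have "\<dots> \<le> ?G n ?x + b * inner ?d (D ?x) + b * norm (H ?x) + L * (r (Suc n))\<^sup>2"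
    proof (intro add_mono order_refl mult_left_mono bd)
      show "?G (Suc n) ?x \<le> ?G n ?x"
        by (intro mixture_update_le[of "surrogates \<Theta> L", OF subset_refl upd] algorithm2_in_domain[OF alg])
      show "inner ?d (H ?x) \<le> norm (H ?x)"
        using norm_cauchy_schwarz[of ?d "H ?x"] y(2) mult_right_mono[of "norm ?d" 1 "norm (H ?x)"] by simp
    qed (use b L_pos in auto)
    finally have "b * (- inner ?d (D ?x)) \<le> X"
      using H_x unfolding X_def by simp
    moreover have "dir_deriv (mixture \<pi> f) ?x ?d = inner ?d (D ?x)"
      using D unfolding has_lipschitz_gradient_def by (intro dir_deriv_eqI has_dir_deriv_gderiv) simp
    ultimately show "- dir_deriv (mixture \<pi> f) ?x ?d \<le> X / b"
      using b by (simp add: field_simps)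
  qed
  then have "ennreal b * e2ennreal (opt_gap \<Theta> (mixture \<pi> f) ?x) \<le> ennreal b * ennreal (X / b)"
    by (intro mult_left_mono) auto
  also have "\<dots> = ennreal X"
    using b by (simp add: ennreal_mult'[symmetric])
  finally show ?thesis
    unfolding b_def X_def .
qed

lemma algorithm2_sum_gap_le:
  assumes alg: "algorithm2 \<Theta> \<pi> f L r v \<theta> g"
    and smooth: "\<And>w. has_lipschitz_gradient L (f w) (F w)"
    and r: "\<And>n. 1 \<le> n \<Longrightarrow> 0 < r n \<and> r (Suc n) \<le> r n"
  shows "(\<Sum>n=1..N. ennreal (min 1 (r (n + 1))) * e2ennreal (opt_gap \<Theta> (mixture \<pi> f) (\<theta> n))) \<le>
    ennreal (initial_gap \<Theta> \<pi> f (g 0) (\<theta> 0) + L * (\<Sum>n=1..N. (r n)\<^sup>2)) +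
    ennreal L * (\<Sum>i=1..N. ennreal ((r i)\<^sup>2) * (\<Sum>w\<in>UNIV. hit_time v i w * ennreal (\<pi> w)))"
proof -
  let ?A = "\<lambda>n. L * (\<Sum>w\<in>UNIV. \<pi> w * (\<Sum>i=last_visit v n w..n. (r i)\<^sup>2))"
  let ?G = "\<lambda>n. mixture \<pi> (g n) (\<theta> n)"
  let ?B = "\<lambda>n. ?G n - ?G (Suc n) + L * (r (Suc n))\<^sup>2"
  have A: "0 \<le> ?A n" for n
    using L_pos weight_nonneg by (intro mult_nonneg_nonneg sum_nonneg) auto
  have dec: "?G (Suc n) \<le> ?G n" for n
    using algorithm2_step_decrease[OF alg, of n] r[of "Suc n"] by simp
  have B: "0 \<le> ?B n" for n
    using dec[of n] L_pos by simp
  have "(\<Sum>n=1..N. ennreal (min 1 (r (n + 1))) * e2ennreal (opt_gap \<Theta> (mixture \<pi> f) (\<theta> n)))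
      \<le> (\<Sum>n=1..N. ennreal (?B n + ?A n))"
    using algorithm2_gap_le[OF alg smooth r] by (intro sum_mono) auto
  also have "\<dots> = (\<Sum>n=1..N. ennreal (?B n)) + (\<Sum>n=1..N. ennreal (?A n))"
    using A B unfolding sum.distrib[symmetric] by (intro sum.cong) (auto simp: ennreal_plus)
  also have "\<dots> = ennreal (\<Sum>n=1..N. ?B n) + ennreal (\<Sum>n=1..N. ?A n)"
    using A B by (subst (1 2) sum_ennreal) auto
  also have "\<dots> \<le> ennreal (initial_gap \<Theta> \<pi> f (g 0) (\<theta> 0) + L * (\<Sum>n=1..N. (r n)\<^sup>2)) +
    ennreal L * (\<Sum>i=1..N. ennreal ((r i)\<^sup>2) * (\<Sum>w\<in>UNIV. hit_time v i w * ennreal (\<pi> w)))"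
  proof (intro add_mono weighted_sum_since_last_visit_le ennreal_leI)
    have "(\<Sum>n=1..N. ?B n) = (\<Sum>n=1..N. ?G n - ?G (Suc n)) + L * (\<Sum>n=1..N. (r (Suc n))\<^sup>2)"
      by (simp add: sum.distrib sum_distrib_left)
    \<comment> \<open>The gap at \<open>\<theta> n\<close> is controlled by the step to
      \<open>n + 1\<close>, so the telescoping sum starts at \<open>?G 1\<close>; one further
      decrease reaches the initial value.\<close>
    moreover have "(\<Sum>n=1..N. ?G n - ?G (Suc n)) = ?G 1 - ?G (Suc N)"
      by (induction N) auto
    moreover have "?G 1 \<le> ?G 0"
      using dec[of 0] by simp
    moreover have "(INF x\<in>\<Theta>. mixture \<pi> f x) \<le> ?G (Suc N)"
      using alg algorithm2_in_domain[OF alg] unfolding algorithm2_def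
      by (intro Inf_le_mixture_surrogate[of "surrogates \<Theta> L"]) auto
    \<comment> \<open>Monotonicity of the radii absorbs the index shift.\<close>
    moreover have "L * (\<Sum>n=1..N. (r (Suc n))\<^sup>2) \<le> L * (\<Sum>n=1..N. (r n)\<^sup>2)"
      using r L_pos by (intro mult_left_mono sum_mono power_mono) (auto simp: less_imp_le)
    ultimately show "(\<Sum>n=1..N. ?B n) \<le> initial_gap \<Theta> \<pi> f (g 0) (\<theta> 0) + L * (\<Sum>n=1..N. (r n)\<^sup>2)"
      unfolding initial_gap_def by linarith
  qed simp
  finally show ?thesis .
qed

end

section \<open>Expected age of the oldest surrogate\<close>

text \<open>On the unit interval a convex function lies below its chord; here the chord runs from
  \<open>1\<close> to \<open>2\<close>.\<close>

lemma two_powr_le: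
  fixes u :: real
  assumes "0 \<le> u" "u \<le> 1"
  shows "2 powr u \<le> 1 + u"
proof -
  have "exp ((1 - u) *\<^sub>R 0 + u *\<^sub>R ln 2) \<le> (1 - u) * exp 0 + u * exp (ln (2::real))"
    using exp_convex assms by (intro convex_onD[of UNIV]) auto
  then show ?thesis
    by (simp add: powr_def)
qed

text \<open>The factor \<open>2 / 2 ^ K\<close> of this geometric tail is what offsets the number of
  states in the union bound.\<close>

lemma sum_half_powers_le:
  "(\<Sum>k=K..<n. 1 / 2 ^ k) \<le> (2 / 2 ^ K :: real)"
proof (cases "K \<le> n")
  case True
  then have "(\<Sum>k=K..<n. (1 / 2) ^ k) = (2 * (1 / 2) ^ K - 2 * (1 / 2) ^ n :: real)"
    by (induction n rule: dec_induct) auto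
  then show ?thesis by (simp add: power_one_over)
qed simp

text \<open>Splitting at \<open>K = \<lceil>log\<^sub>2 V\<rceil>\<close> costs nothing against \<open>log\<^sub>2 (4 V)\<close>: with
  \<open>u = 1 + log\<^sub>2 V - K\<close> the claim reads \<open>2\<^sup>u \<le> 1 + u\<close>.\<close>

lemma ceiling_log_plus_tail_le:
  fixes V :: real
  assumes V: "1 \<le> V"
  defines "K \<equiv> nat \<lceil>log 2 V\<rceil>"
  shows "real K + V * (2 / 2 ^ K) \<le> log 2 (4 * V)"
proof -
  define x where "x = log 2 V"
  have x: "0 \<le> x" "V = 2 powr x"
    using V unfolding x_def by auto
  have K: "x \<le> real K" "real K < x + 1"
    using x(1) unfolding K_def x_def[symmetric] by linarith+
  have "V * (2 / 2 ^ K) = 2 powr (1 + x - real K)"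
    by (simp add: x(2) powr_diff powr_add powr_realpow)
  also have "\<dots> \<le> 1 + (1 + x - real K)"
    using K by (intro two_powr_le) auto
  finally have "real K + V * (2 / 2 ^ K) \<le> 2 + x"
    by simp
  also have "log 2 4 = (2::real)"
    using log_pow_cancel[of 2 2] by simp
  then have "2 + x = log 2 (4 * V)"
    using V unfolding x_def by (subst log_mult) auto
  finally show ?thesis .
qed

text \<open>Separates the constant from \<open>dyn_reg 0\<close>, the age of the oldest surrogate
  and the only random part.\<close>

lemma dyn_reg_eq: "dyn_reg \<rho> v n = \<rho> + dyn_reg 0 v n"
  unfolding dyn_reg_def by simp

lemma dyn_reg_attained:
  assumes "1 \<le> n"
  obtains w where "dyn_reg 0 v n = real (n - last_visit v n w)"
proof -
  have "(MAX w. real n - real (last_visit v n w)) \<in> range (\<lambda>w. real n - real (last_visit v n w))"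
    by (intro Max_in) auto
  then obtain w where "(MAX w. real n - real (last_visit v n w)) = real n - real (last_visit v n w)"
    by (rule imageE)
  then have "dyn_reg 0 v n = real n - real (last_visit v n w)"
    unfolding dyn_reg_def by simp
  then show ?thesis
    using last_visit_le[OF assms, of v w] by (intro that[of w]) (simp add: of_nat_diff)
qed

lemma dyn_reg_bounds:
  assumes "1 \<le> n"
  shows "0 \<le> dyn_reg 0 v n" "dyn_reg 0 v n \<le> real n"
  by (rule dyn_reg_attained[OF assms, of v], simp)+

text \<open>Let \<open>w\<close> attain the maximal age \<open>m\<close>. Every window of the last
  \<open>k * s\<close> samples with \<open>k * s \<le> m\<close> misses \<open>w\<close>, so
  \<open>m div s + 1\<close> is at most \<open>K\<close> plus the number of such
  \<open>k \<ge> K\<close>; summing over all states bounds that number. The guard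
  \<open>k * s < n\<close> keeps \<open>n - k * s\<close> at least one.\<close>

lemma dyn_reg_le_sum_of_bool:
  fixes v :: "nat \<Rightarrow> 'v::finite"
  assumes n: "1 \<le> n" and s: "0 < s"
  shows "dyn_reg 0 v n \<le> real s * (real K +
    (\<Sum>k=K..<n. \<Sum>w\<in>UNIV. of_bool (k * s < n \<and> (\<forall>j\<in>{n - k * s<..n - k * s + k * s}. v j \<noteq> w))))"
proof -
  let ?E = "\<lambda>k w. of_bool (k * s < n \<and> (\<forall>j\<in>{n - k * s<..n - k * s + k * s}. v j \<noteq> w)) :: real"
  obtain w where w: "dyn_reg 0 v n = real (n - last_visit v n w)"
    by (rule dyn_reg_attained[OF n])
  define m where "m = n - last_visit v n w"
  have m: "m < n"
    using n last_visit_ge_1[of v n w] unfolding m_def by linarith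
  \<comment> \<open>The last visit is at \<open>n - m \<le> n - k * s\<close>, so no later sample up
    to \<open>n\<close> equals \<open>w\<close>; this covers the default value \<open>1\<close> as
    well.\<close>
  have E: "?E k w = 1" if k: "k * s \<le> m" for k
  proof -
    have "v j \<noteq> w" if "n - k * s < j" "j \<le> n" for j
      using le_last_visit[of j n v w] that k unfolding m_def by auto
    then show ?thesis
      using k m by auto
  qed
  define q where "q = m div s"
  have q: "m < s * Suc q" "q * s \<le> m"
    unfolding q_def using s dividend_less_times_div[of s m] by (auto simp: div_times_less_eq_dividend)
  \<comment> \<open>Since \<open>s\<close> is positive, \<open>q \<le> m < n\<close>, which keeps
    the summation range inside \<open>{K..<n}\<close>.\<close>
  have "q \<le> q * s"
    using s by (cases s) auto
  then have "q < n"
    using q(2) m by linarith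
  have "real (Suc q) \<le> real K + (\<Sum>k=K..<Suc q. 1)"
    by simp
  also have "(\<Sum>k=K..<Suc q. 1) \<le> (\<Sum>k=K..<Suc q. \<Sum>w\<in>UNIV. ?E k w)"
  proof (rule sum_mono)
    fix k assume "k \<in> {K..<Suc q}"
    then have "k * s \<le> q * s"
      by (intro mult_le_mono1) simp
    then have "k * s \<le> m"
      using q(2) by linarith
    then have "1 = ?E k w"
      by (rule E[symmetric])
    also have "\<dots> \<le> (\<Sum>w\<in>UNIV. ?E k w)"
      by (rule member_le_sum) auto
    finally show "1 \<le> (\<Sum>w\<in>UNIV. ?E k w)" .
  qed
  also have "\<dots> \<le> (\<Sum>k=K..<n. \<Sum>w\<in>UNIV. ?E k w)"
    using \<open>q < n\<close> by (intro sum_mono2 sum_nonneg) auto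
  finally have "real s * real (Suc q) \<le> real s * (real K + (\<Sum>k=K..<n. \<Sum>w\<in>UNIV. ?E k w))"
    by (intro mult_left_mono) auto
  moreover have "dyn_reg 0 v n \<le> real s * real (Suc q)"
    using q(1) unfolding w m_def[symmetric] of_nat_mult[symmetric] of_nat_le_iff by simp
  ultimately show ?thesis
    by linarith
qed

locale sampled_process = prob_space M for M :: "'w measure" +
  fixes v :: "nat \<Rightarrow> 'w \<Rightarrow> 'v::finite" and \<theta> :: "nat \<Rightarrow> 'w \<Rightarrow> 'a::euclidean_space"
  assumes sample_measurable: "\<And>n. 1 \<le> n \<Longrightarrow> v n \<in> measurable M (count_space UNIV)"
    and iterate_measurable [measurable]: "\<And>n. \<theta> n \<in> borel_measurable M"
    and recurrent: "recurrent M v \<theta>"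
begin

section \<open>Hitting times integrated against quantities known at time \<open>n\<close>\<close>

lemma space_history [simp]: "space (history M v \<theta> n) = space M"
  unfolding history_def by (simp add: space_measure_of_conv)

lemma history_generators:
  "(\<Union>i\<in>{1..n}. {v i -` A \<inter> space M | A. A \<in> UNIV}) \<union>
      (\<Union>i\<in>{0..n}. {\<theta> i -` B \<inter> space M | B. B \<in> sets borel}) \<subseteq> sets (history M v \<theta> n)"
  unfolding history_def by (subst sets_measure_of) (auto intro!: sigma_sets.Basic)

lemma sample_history_measurable:
  assumes "1 \<le> i" "i \<le> n"
  shows "v i \<in> measurable (history M v \<theta> n) (count_space UNIV)"
  using assms history_generators[of n] by (intro measurableI) force+

lemma iterate_history_measurable:
  assumes "i \<le> n"
  shows "\<theta> i \<in> borel_measurable (history M v \<theta> n)"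
  using assms history_generators[of n] by (intro measurableI) force+

text \<open>A finite measure stays finite on a sub-sigma-algebra; this gives access to the defining
  property of \<open>nn_cond_exp\<close>.\<close>

lemma sigma_finite_history: "sigma_finite_subalgebra M (history M v \<theta> n)"
proof -
  have "subalgebra M (history M v \<theta> n)"
    by (intro subalgebra_history sample_measurable iterate_measurable)
  then show ?thesis
    by (intro finite_measure_subalgebra_is_sigma_finite)
      (simp add: finite_measure_subalgebra_def finite_measure_subalgebra_axioms_def finite_measure_axioms)
qed

lemma borel_measurable_history:
  assumes "Z \<in> borel_measurable (history M v \<theta> n)"
  shows "Z \<in> borel_measurable M"
  by (rule measurable_from_subalg[OF sigma_finite_subalgebra.subalg[OF sigma_finite_history] assms])

lemma hit_time_borel_measurable [measurable]:
  "(\<lambda>\<omega>. hit_time (\<lambda>i. v i \<omega>) n w) \<in> borel_measurable M"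
  by (intro hit_time_measurable sample_measurable)

lemma cond_hit_borel_measurable [measurable]: "cond_hit M v \<theta> n w \<in> borel_measurable M"
  unfolding cond_hit_def by simp

lemma nn_integral_mult_hit_time:
  assumes "Z \<in> borel_measurable (history M v \<theta> n)"
  shows "(\<integral>\<^sup>+\<omega>. Z \<omega> * hit_time (\<lambda>i. v i \<omega>) n w \<partial>M) = (\<integral>\<^sup>+\<omega>. Z \<omega> * cond_hit M v \<theta> n w \<omega> \<partial>M)"
proof -
  interpret sigma_finite_subalgebra M "history M v \<theta> n"
    by (rule sigma_finite_history)
  show ?thesis
    unfolding cond_hit_def by (intro nn_cond_exp_intg[symmetric] assms hit_time_borel_measurable)
qed

lemma nn_integral_mult_hit_time_le:
  assumes Z: "Z \<in> borel_measurable (history M v \<theta> n)" and n: "1 \<le> n"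
  shows "(\<integral>\<^sup>+\<omega>. Z \<omega> * hit_time (\<lambda>i. v i \<omega>) n w \<partial>M) \<le> t_hit M v \<theta> * (\<integral>\<^sup>+\<omega>. Z \<omega> \<partial>M)"
proof -
  note [measurable] = borel_measurable_history[OF Z]
  have "esssup M (cond_hit M v \<theta> n w) \<le> (SUP n\<in>{1..}. esssup M (cond_hit M v \<theta> n w))"
    using n by (intro SUP_upper) simp
  also have "\<dots> \<le> t_hit M v \<theta>"
    unfolding t_hit_def by (intro Max_ge) auto
  finally have "AE \<omega> in M. cond_hit M v \<theta> n w \<omega> \<le> t_hit M v \<theta>"
    using esssup_AE[of "cond_hit M v \<theta> n w" M] by (auto elim: eventually_mono)
  then have "(\<integral>\<^sup>+\<omega>. Z \<omega> * cond_hit M v \<theta> n w \<omega> \<partial>M) \<le> (\<integral>\<^sup>+\<omega>. t_hit M v \<theta> * Z \<omega> \<partial>M)"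
    by (intro nn_integral_mono_AE) (auto elim!: eventually_mono simp: mult.commute intro: mult_left_mono)
  then show ?thesis
    unfolding nn_integral_mult_hit_time[OF Z] by (simp add: nn_integral_cmult)
qed

text \<open>The essential supremum in \<open>t_odot\<close> is that of a weighted sum. The integral
  is therefore split over \<open>w\<close> only to replace hitting times by conditional
  expectations, and reassembled before it is bounded.\<close>

lemma nn_integral_mult_weighted_hit_time_le:
  assumes Z: "Z \<in> borel_measurable (history M v \<theta> n)" and n: "1 \<le> n"
  shows "(\<integral>\<^sup>+\<omega>. Z \<omega> * (\<Sum>w\<in>UNIV. hit_time (\<lambda>i. v i \<omega>) n w * ennreal (\<pi> w)) \<partial>M)
    \<le> t_odot M \<pi> v \<theta> * (\<integral>\<^sup>+\<omega>. Z \<omega> \<partial>M)"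
proof -
  note [measurable] = borel_measurable_history[OF Z]
  have "(\<integral>\<^sup>+\<omega>. Z \<omega> * (\<Sum>w\<in>UNIV. hit_time (\<lambda>i. v i \<omega>) n w * ennreal (\<pi> w)) \<partial>M)
      = (\<integral>\<^sup>+\<omega>. (\<Sum>w\<in>UNIV. Z \<omega> * hit_time (\<lambda>i. v i \<omega>) n w * ennreal (\<pi> w)) \<partial>M)"
    by (simp add: sum_distrib_left mult.assoc)
  also have "\<dots> = (\<Sum>w\<in>UNIV. (\<integral>\<^sup>+\<omega>. Z \<omega> * hit_time (\<lambda>i. v i \<omega>) n w \<partial>M) * ennreal (\<pi> w))"
    by (subst nn_integral_sum) (auto simp: nn_integral_multc)
  also have "\<dots> = (\<Sum>w\<in>UNIV. (\<integral>\<^sup>+\<omega>. Z \<omega> * cond_hit M v \<theta> n w \<omega> \<partial>M) * ennreal (\<pi> w))"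
    by (simp add: nn_integral_mult_hit_time[OF Z])
  also have "\<dots> = (\<integral>\<^sup>+\<omega>. (\<Sum>w\<in>UNIV. Z \<omega> * cond_hit M v \<theta> n w \<omega> * ennreal (\<pi> w)) \<partial>M)"
    by (subst nn_integral_sum) (auto simp: nn_integral_multc)
  also have "\<dots> = (\<integral>\<^sup>+\<omega>. (\<Sum>w\<in>UNIV. cond_hit M v \<theta> n w \<omega> * ennreal (\<pi> w)) * Z \<omega> \<partial>M)"
    unfolding sum_distrib_right by (simp add: ac_simps)
  also have "\<dots> \<le> (\<integral>\<^sup>+\<omega>. t_odot M \<pi> v \<theta> * Z \<omega> \<partial>M)"
  proof (rule nn_integral_mono_AE)
    have "esssup M (\<lambda>\<omega>. \<Sum>w\<in>UNIV. cond_hit M v \<theta> n w \<omega> * ennreal (\<pi> w)) \<le> t_odot M \<pi> v \<theta>"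
      unfolding t_odot_def using n by (intro SUP_upper) simp
    then have "AE \<omega> in M. (\<Sum>w\<in>UNIV. cond_hit M v \<theta> n w \<omega> * ennreal (\<pi> w)) \<le> t_odot M \<pi> v \<theta>"
      using esssup_AE[of "\<lambda>\<omega>. \<Sum>w\<in>UNIV. cond_hit M v \<theta> n w \<omega> * ennreal (\<pi> w)" M]
      by (auto elim: eventually_mono)
    then show "AE \<omega> in M. (\<Sum>w\<in>UNIV. cond_hit M v \<theta> n w \<omega> * ennreal (\<pi> w)) * Z \<omega> \<le> t_odot M \<pi> v \<theta> * Z \<omega>"
      by (auto elim!: eventually_mono intro: mult_right_mono)
  qed
  also have "\<dots> = t_odot M \<pi> v \<theta> * (\<integral>\<^sup>+\<omega>. Z \<omega> \<partial>M)"
    by (simp add: nn_integral_cmult)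
  finally show ?thesis .
qed

text \<open>Passage from paths to expectations: \<open>Y\<close> enters only through monotonicity of
  the lower integral, and each \<open>a i\<close> is known at time \<open>i\<close>. The result is
  kept under one integral so that Cauchy-Schwarz can still be applied path by path.\<close>

lemma nn_integral_sum_weighted_hit_times_le:
  fixes a :: "nat \<Rightarrow> 'w \<Rightarrow> real" and c :: "'w \<Rightarrow> real"
  assumes \<pi>: "\<And>w. 0 \<le> \<pi> w" "(\<Sum>w\<in>UNIV. \<pi> w) = 1"
    and a: "\<And>i. a i \<in> borel_measurable (history M v \<theta> i)" "\<And>i \<omega>. 0 \<le> a i \<omega>"
    and c: "c \<in> borel_measurable M" "\<And>\<omega>. \<omega> \<in> space M \<Longrightarrow> 0 \<le> c \<omega>" and L: "0 \<le> L"
    and Y: "\<And>\<omega>. \<omega> \<in> space M \<Longrightarrow> Y \<omega> \<le> ennreal (c \<omega>) + ennreal L *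
      (\<Sum>i=1..N. ennreal (a i \<omega>) * (\<Sum>w\<in>UNIV. hit_time (\<lambda>i. v i \<omega>) i w * ennreal (\<pi> w)))"
  shows "(\<integral>\<^sup>+\<omega>. Y \<omega> \<partial>M)
    \<le> (\<integral>\<^sup>+\<omega>. ennreal (c \<omega> + L * enn2real (t_odot M \<pi> v \<theta>) * (\<Sum>i=1..N. a i \<omega>)) \<partial>M)"
proof -
  define T where "T = enn2real (t_odot M \<pi> v \<theta>)"
  \<comment> \<open>Recurrence makes \<open>t_odot\<close> finite, so passing to its real value is
    exact.\<close>
  have T: "t_odot M \<pi> v \<theta> = ennreal T" "0 \<le> T"
    using t_odot_finite[OF recurrent \<pi>(2,1)] unfolding T_def by auto
  note [measurable] = borel_measurable_history[OF a(1)] c(1)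
  let ?h = "\<lambda>i \<omega>. \<Sum>w\<in>UNIV. hit_time (\<lambda>i. v i \<omega>) i w * ennreal (\<pi> w)"
  have "(\<integral>\<^sup>+\<omega>. Y \<omega> \<partial>M) \<le> (\<integral>\<^sup>+\<omega>. ennreal (c \<omega>) + ennreal L * (\<Sum>i=1..N. ennreal (a i \<omega>) * ?h i \<omega>) \<partial>M)"
    by (intro nn_integral_mono Y)
  also have "\<dots> = (\<integral>\<^sup>+\<omega>. ennreal (c \<omega>) \<partial>M) + ennreal L * (\<Sum>i=1..N. \<integral>\<^sup>+\<omega>. ennreal (a i \<omega>) * ?h i \<omega> \<partial>M)"
    by (simp add: nn_integral_add nn_integral_cmult nn_integral_sum)
  also have "\<dots> \<le> (\<integral>\<^sup>+\<omega>. ennreal (c \<omega>) \<partial>M) + ennreal L * (\<Sum>i=1..N. ennreal T * (\<integral>\<^sup>+\<omega>. ennreal (a i \<omega>) \<partial>M))"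
  proof (intro add_left_mono mult_left_mono sum_mono)
    fix i assume "i \<in> {1..N}"
    moreover have "(\<lambda>\<omega>. ennreal (a i \<omega>)) \<in> borel_measurable (history M v \<theta> i)"
      using a(1)[of i] by measurable
    ultimately show "(\<integral>\<^sup>+\<omega>. ennreal (a i \<omega>) * ?h i \<omega> \<partial>M) \<le> ennreal T * (\<integral>\<^sup>+\<omega>. ennreal (a i \<omega>) \<partial>M)"
      unfolding T(1)[symmetric] by (intro nn_integral_mult_weighted_hit_time_le) auto
  qed simp
  also have "\<dots> = (\<integral>\<^sup>+\<omega>. ennreal (c \<omega>) + ennreal L * (\<Sum>i=1..N. ennreal T * ennreal (a i \<omega>)) \<partial>M)"
    by (simp add: nn_integral_add nn_integral_cmult nn_integral_sum)
  also have "\<dots> = (\<integral>\<^sup>+\<omega>. ennreal (c \<omega> + L * T * (\<Sum>i=1..N. a i \<omega>)) \<partial>M)"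
  proof (rule nn_integral_cong)
    fix \<omega> assume \<omega>: "\<omega> \<in> space M"
    have "(\<Sum>i=1..N. ennreal T * ennreal (a i \<omega>)) = ennreal (T * (\<Sum>i=1..N. a i \<omega>))"
      using T(2) a(2) by (simp add: ennreal_mult[symmetric] sum_distrib_left)
    then have "ennreal L * (\<Sum>i=1..N. ennreal T * ennreal (a i \<omega>)) = ennreal (L * T * (\<Sum>i=1..N. a i \<omega>))"
      using T(2) a(2) L by (simp add: ennreal_mult[symmetric] sum_nonneg mult.assoc)
    moreover have "0 \<le> L * T * (\<Sum>i=1..N. a i \<omega>)"
      using T(2) a(2) L by (simp add: sum_nonneg)
    ultimately show "ennreal (c \<omega>) + ennreal L * (\<Sum>i=1..N. ennreal T * ennreal (a i \<omega>))
        = ennreal (c \<omega> + L * T * (\<Sum>i=1..N. a i \<omega>))"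
      using c(2)[OF \<omega>] by (simp add: ennreal_plus)
  qed
  finally show ?thesis
    unfolding T_def .
qed

section \<open>Long stretches of samples that miss a state\<close>

definition unvisited :: "nat \<Rightarrow> nat \<Rightarrow> 'v \<Rightarrow> 'w set" where
  "unvisited m l w = {\<omega> \<in> space M. \<forall>j\<in>{m<..m + l}. v j \<omega> \<noteq> w}"

text \<open>All samples of the window have been observed by its end \<open>m + l\<close>, so the
  indicator of the event may multiply a hitting time counted from there.\<close>

lemma unvisited_history: "unvisited m l w \<in> sets (history M v \<theta> (m + l))"
proof -
  have "unvisited m l w = {\<omega> \<in> space (history M v \<theta> (m + l)). \<forall>j\<in>{m<..m + l}. v j \<omega> \<noteq> w}"
    unfolding unvisited_def by simp
  also have "\<dots> \<in> sets (history M v \<theta> (m + l))"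
  proof (rule sets.sets_Collect_finite_All)
    fix j assume "j \<in> {m<..m + l}"
    then have [measurable]: "v j \<in> measurable (history M v \<theta> (m + l)) (count_space UNIV)"
      by (intro sample_history_measurable) auto
    show "{\<omega> \<in> space (history M v \<theta> (m + l)). v j \<omega> \<noteq> w} \<in> sets (history M v \<theta> (m + l))"
      by measurable
  qed simp
  finally show ?thesis .
qed

lemma unvisited_events [measurable]: "unvisited m l w \<in> events"
  using unvisited_history[of m l w] sigma_finite_history[of "m + l"]
  by (auto simp: sigma_finite_subalgebra_def subalgebra_def)

text \<open>A visit after time \<open>m + l\<close> comes more than \<open>s\<close> steps later;
  the weaker bound by \<open>s\<close> is the form used with Markov's inequality.\<close>

lemma hit_time_ge_unvisited:
  assumes "\<omega> \<in> unvisited m (l + s) w"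
  shows "of_nat s \<le> hit_time (\<lambda>i. v i \<omega>) (m + l) w"
  unfolding hit_time_def
proof (intro INF_greatest)
  fix j assume "j \<in> {j. 1 \<le> j \<and> v (m + l + j) \<omega> = w}"
  then have "\<not> j \<le> s"
    using assms unfolding unvisited_def by fastforce
  then show "of_nat s \<le> (of_nat j :: ennreal)"
    by simp
qed

text \<open>Markov's inequality for the hitting time, conditionally on the past.\<close>

lemma prob_unvisited_half:
  assumes m: "1 \<le> m" and s: "0 < s" "2 * enn2real (t_hit M v \<theta>) \<le> real s"
  shows "prob (unvisited m (l + s) w) \<le> prob (unvisited m l w) / 2"
proof -
  define t where "t = enn2real (t_hit M v \<theta>)"
  have t: "t_hit M v \<theta> = ennreal t" "0 \<le> t"
    using t_hit_finite[OF recurrent] unfolding t_def by auto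
  let ?A = "unvisited m l w" and ?B = "unvisited m (l + s) w"
  have "ennreal (real s * prob ?B) = (\<integral>\<^sup>+\<omega>. of_nat s * indicator ?B \<omega> \<partial>M)"
    by (simp add: nn_integral_cmult_indicator ennreal_mult emeasure_eq_measure ennreal_of_nat_eq_real_of_nat)
  also have "\<dots> \<le> (\<integral>\<^sup>+\<omega>. indicator ?A \<omega> * hit_time (\<lambda>i. v i \<omega>) (m + l) w \<partial>M)"
  proof (rule nn_integral_mono)
    fix \<omega>
    have "\<omega> \<in> ?A" if "\<omega> \<in> ?B"
      using that unfolding unvisited_def by auto
    then show "of_nat s * indicator ?B \<omega> \<le> indicator ?A \<omega> * hit_time (\<lambda>i. v i \<omega>) (m + l) w"
      using hit_time_ge_unvisited[of \<omega> m l s w] by (auto split: split_indicator)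
  qed
  also have "\<dots> \<le> t_hit M v \<theta> * (\<integral>\<^sup>+\<omega>. indicator ?A \<omega> \<partial>M)"
    using m unvisited_history by (intro nn_integral_mult_hit_time_le) auto
  also have "\<dots> = ennreal (t * prob ?A)"
    using t by (simp add: emeasure_eq_measure ennreal_mult)
  finally have "real s * prob ?B \<le> t * prob ?A"
    using t(2) by (subst (asm) ennreal_le_iff) auto
  also have "\<dots> \<le> real s / 2 * prob ?A"
    using s(2) unfolding t_def by (intro mult_right_mono) auto
  finally have "real s * prob ?B \<le> real s * (prob ?A / 2)"
    by simp
  then show ?thesis
    using s(1) by simp
qed

lemma prob_unvisited_le:
  assumes m: "1 \<le> m" and s: "0 < s" "2 * enn2real (t_hit M v \<theta>) \<le> real s"
  shows "prob (unvisited m (k * s) w) \<le> 1 / 2 ^ k"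
proof (induction k)
  case (Suc k)
  have "prob (unvisited m (k * s + s) w) \<le> prob (unvisited m (k * s) w) / 2"
    by (rule prob_unvisited_half[OF m s])
  with Suc show ?case
    by (simp add: add.commute)
qed simp

lemma last_visit_measurable [measurable]:
  "(\<lambda>\<omega>. last_visit (\<lambda>i. v i \<omega>) n w) \<in> measurable M (count_space UNIV)"
proof (induction n)
  case (Suc n)
  note [measurable] = Suc sample_measurable[of "Suc n", simplified]
  show ?case
    unfolding last_visit_Suc by measurable
qed simp

lemma dyn_reg_measurable [measurable]:
  "(\<lambda>\<omega>. dyn_reg \<rho> (\<lambda>i. v i \<omega>) n) \<in> borel_measurable M"
  unfolding dyn_reg_def by (intro borel_measurable_add borel_measurable_const borel_measurable_Max) auto

lemma dyn_reg_integrable: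
  assumes "1 \<le> n"
  shows "integrable M (\<lambda>\<omega>. dyn_reg 0 (\<lambda>i. v i \<omega>) n)"
  by (intro integrable_const_bound[of _ "real n"] AE_I2)
    (simp_all add: abs_of_nonneg dyn_reg_bounds[OF assms])

text \<open>The first \<open>K\<close> block counts are charged in full, the others by a union bound
  over the states, each of which misses \<open>k\<close> blocks with probability at most
  \<open>1 / 2 ^ k\<close>.\<close>

lemma expectation_dyn_reg_le:
  assumes n: "1 \<le> n"
  shows "expectation (\<lambda>\<omega>. dyn_reg 0 (\<lambda>i. v i \<omega>) n)
    \<le> (2 * enn2real (t_hit M v \<theta>) + 1) * log 2 (4 * real CARD('v))"
proof -
  define t where "t = enn2real (t_hit M v \<theta>)"
  \<comment> \<open>An integer block length between \<open>2 * t\<close> and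
    \<open>2 * t + 1\<close> that is positive even for \<open>t = 0\<close>; its upper bound is the
    first factor of the claim.\<close>
  define s where "s = nat \<lfloor>2 * t\<rfloor> + 1"
  \<comment> \<open>From this index on, the union bound \<open>CARD('v) / 2 ^ k\<close> is at most
    one.\<close>
  define K where "K = nat \<lceil>log 2 (real CARD('v))\<rceil>"
  have "0 \<le> t"
    unfolding t_def by simp
  then have s: "0 < s" "2 * t \<le> real s" "real s \<le> 2 * t + 1"
    unfolding s_def by linarith+
  let ?I = "\<lambda>k w. {\<omega> \<in> unvisited (n - k * s) (k * s) w. k * s < n}"
  have [measurable]: "?I k w \<in> events" for k w
    by measurable
  have prob_le: "prob (?I k w) \<le> 1 / 2 ^ k" for k w
  proof (cases "k * s < n")
    case True
    then show ?thesis
      using prob_unvisited_le[of "n - k * s" s k w] s unfolding t_def by simp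
  qed simp
  have "expectation (\<lambda>\<omega>. dyn_reg 0 (\<lambda>i. v i \<omega>) n)
      \<le> expectation (\<lambda>\<omega>. real s * (real K + (\<Sum>k=K..<n. \<Sum>w\<in>UNIV. indicator (?I k w) \<omega>)))"
  proof (rule integral_mono)
    show "integrable M (\<lambda>\<omega>. dyn_reg 0 (\<lambda>i. v i \<omega>) n)"
      by (rule dyn_reg_integrable[OF n])
    show "integrable M (\<lambda>\<omega>. real s * (real K + (\<Sum>k=K..<n. \<Sum>w\<in>UNIV. indicator (?I k w) \<omega>)))"
      by (auto simp: emeasure_eq_measure)
    fix \<omega> assume \<omega>: "\<omega> \<in> space M"
    have "of_bool (k * s < n \<and> (\<forall>j\<in>{n - k * s<..n - k * s + k * s}. v j \<omega> \<noteq> w)) = (indicator (?I k w) \<omega> :: real)" for k w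
      using \<omega> unfolding unvisited_def by (auto split: split_indicator)
    then show "dyn_reg 0 (\<lambda>i. v i \<omega>) n \<le> real s * (real K + (\<Sum>k=K..<n. \<Sum>w\<in>UNIV. indicator (?I k w) \<omega>))"
      using dyn_reg_le_sum_of_bool[OF n s(1), of "\<lambda>i. v i \<omega>" K] by simp
  qed
  also have "\<dots> = real s * (real K + (\<Sum>k=K..<n. \<Sum>w\<in>UNIV. prob (?I k w)))"
    by (simp add: Bochner_Integration.integral_sum emeasure_eq_measure prob_space)
  also have "\<dots> \<le> real s * (real K + (\<Sum>k=K..<n. \<Sum>w\<in>(UNIV::'v set). 1 / 2 ^ k))"
    by (intro mult_left_mono add_left_mono sum_mono prob_le) auto
  also have "\<dots> = real s * (real K + real CARD('v) * (\<Sum>k=K..<n. 1 / 2 ^ k))"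
    by (simp add: sum_distrib_left)
  also have "\<dots> \<le> real s * (real K + real CARD('v) * (2 / 2 ^ K))"
    by (intro mult_left_mono add_left_mono sum_half_powers_le) auto
  also have "\<dots> \<le> (2 * t + 1) * log 2 (4 * real CARD('v))"
  proof (intro mult_mono s)
    show "real K + real CARD('v) * (2 / 2 ^ K) \<le> log 2 (4 * real CARD('v))"
      unfolding K_def by (rule ceiling_log_plus_tail_le) (simp add: Suc_leI)
  qed (use \<open>0 \<le> t\<close> in auto)
  finally show ?thesis
    unfolding t_def .
qed

end

section \<open>Rates\<close>

text \<open>Cauchy-Schwarz for the families \<open>sqrt (p i)\<close> and
  \<open>sqrt (p i) * D i\<close>.\<close>

lemma weighted_Cauchy_Schwarz:
  fixes p D :: "'i \<Rightarrow> real"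
  assumes "\<And>i. i \<in> I \<Longrightarrow> 0 \<le> p i" "\<And>i. i \<in> I \<Longrightarrow> 0 \<le> D i"
  shows "(\<Sum>i\<in>I. p i * D i) \<le> sqrt (\<Sum>i\<in>I. p i) * sqrt (\<Sum>i\<in>I. p i * (D i)\<^sup>2)"
proof -
  have "(\<Sum>i\<in>I. p i * D i) = (\<Sum>i\<in>I. \<bar>sqrt (p i)\<bar> * \<bar>sqrt (p i) * D i\<bar>)"
    using assms by (intro sum.cong) (auto simp: abs_mult)
  also have "\<dots> \<le> L2_set (\<lambda>i. sqrt (p i)) I * L2_set (\<lambda>i. sqrt (p i) * D i) I"
    by (rule L2_set_mult_ineq)
  also have "\<dots> = sqrt (\<Sum>i\<in>I. p i) * sqrt (\<Sum>i\<in>I. p i * (D i)\<^sup>2)"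
    using assms by (simp add: L2_set_def power_mult_distrib)
  finally show ?thesis .
qed

lemma sum_increments_le:
  fixes D :: "nat \<Rightarrow> real"
  assumes D: "\<And>n. 0 \<le> D n" and \<mu>: "0 < \<mu>" and le: "(\<Sum>n=1..N. \<mu> / 2 * (D n)\<^sup>2) \<le> \<Delta>"
  shows "(\<Sum>n=1..N. D n) \<le> sqrt (real N) * sqrt (2 * \<Delta> / \<mu>)"
proof -
  have "\<mu> / 2 * (\<Sum>n=1..N. (D n)\<^sup>2) \<le> \<Delta>"
    using le by (simp add: sum_distrib_left)
  then have "(\<Sum>n=1..N. (D n)\<^sup>2) \<le> 2 * \<Delta> / \<mu>"
    using \<mu> by (simp add: field_simps)
  then have "sqrt (real N) * sqrt (\<Sum>n=1..N. (D n)\<^sup>2) \<le> sqrt (real N) * sqrt (2 * \<Delta> / \<mu>)"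
    by (intro mult_left_mono) auto
  moreover have "(\<Sum>n=1..N. D n) \<le> sqrt (real N) * sqrt (\<Sum>n=1..N. (D n)\<^sup>2)"
    using weighted_Cauchy_Schwarz[of "{1..N}" "\<lambda>_. 1" D] D by simp
  ultimately show ?thesis by linarith
qed

text \<open>The bounds \<open>\<rho> \<le> T \<le> \<rho> + \<mu>\<close> make the weights \<open>T + m n\<close> comparable both with the
  coefficients of the increments and with those of their squares.\<close>

lemma regularized_sum_increments_le:
  fixes D m :: "nat \<Rightarrow> real"
  assumes D: "\<And>n. 0 \<le> D n" and m: "\<And>n. n \<in> {1..N} \<Longrightarrow> 0 \<le> m n" and "0 \<le> \<rho>" "0 \<le> T"
    and T: "\<rho> \<le> T" "T \<le> \<rho> + \<mu>"
    and le: "(\<Sum>n=1..N. (\<rho> + m n + \<mu> / 2) * (D n)\<^sup>2) \<le> \<Delta>"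
  shows "(\<Sum>n=1..N. (\<rho> + m n) * D n) + T * (\<Sum>n=1..N. D n)
    \<le> 2 * sqrt (2 * \<Delta>) * sqrt (\<Sum>n=1..N. T + m n)"
proof -
  have "(\<Sum>n=1..N. (\<rho> + m n) * D n) + T * (\<Sum>n=1..N. D n) = (\<Sum>n=1..N. (\<rho> + m n + T) * D n)"
    by (simp add: sum_distrib_left sum.distrib[symmetric] algebra_simps)
  also have "\<dots> \<le> (\<Sum>n=1..N. 2 * ((T + m n) * D n))"
  proof (rule sum_mono)
    fix n assume "n \<in> {1..N}"
    then have "(\<rho> + m n + T) * D n \<le> (2 * (T + m n)) * D n"
      using m[of n] T(1) D by (intro mult_right_mono) auto
    then show "(\<rho> + m n + T) * D n \<le> 2 * ((T + m n) * D n)"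
      by (simp only: mult.assoc)
  qed
  also have "\<dots> = 2 * (\<Sum>n=1..N. (T + m n) * D n)"
    by (simp add: sum_distrib_left)
  also have "(\<Sum>n=1..N. (T + m n) * D n)
      \<le> sqrt (\<Sum>n=1..N. T + m n) * sqrt (\<Sum>n=1..N. (T + m n) * (D n)\<^sup>2)"
    using m D \<open>0 \<le> T\<close> by (intro weighted_Cauchy_Schwarz) auto
  also have "\<dots> \<le> sqrt (\<Sum>n=1..N. T + m n) * sqrt (2 * \<Delta>)"
  proof (intro mult_left_mono real_sqrt_le_mono)
    have "(\<Sum>n=1..N. (T + m n) * (D n)\<^sup>2) \<le> (\<Sum>n=1..N. 2 * ((\<rho> + m n + \<mu> / 2) * (D n)\<^sup>2))"
    proof (rule sum_mono)
      fix n assume "n \<in> {1..N}"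
      then have "(T + m n) * (D n)\<^sup>2 \<le> (2 * (\<rho> + m n + \<mu> / 2)) * (D n)\<^sup>2"
        using m[of n] T(2) \<open>0 \<le> \<rho>\<close> by (intro mult_right_mono) auto
      then show "(T + m n) * (D n)\<^sup>2 \<le> 2 * ((\<rho> + m n + \<mu> / 2) * (D n)\<^sup>2)"
        by (simp only: mult.assoc)
    qed
    also have "\<dots> \<le> 2 * \<Delta>"
      using le by (simp add: sum_distrib_left[symmetric])
    finally show "(\<Sum>n=1..N. (T + m n) * (D n)\<^sup>2) \<le> 2 * \<Delta>" .
    show "0 \<le> sqrt (\<Sum>n=1..N. T + m n)"
      using m \<open>0 \<le> T\<close> by (intro real_sqrt_ge_zero sum_nonneg) auto
  qed
  finally show ?thesis
    by (simp add: mult.commute)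
qed

lemma sqrt_mult_divide_eq:
  fixes N :: real
  assumes "0 < N"
  shows "sqrt (N * X) / N = sqrt (X / N)"
proof -
  have "X / N = N * X / N\<^sup>2"
    using assms by (simp add: power2_eq_square)
  then have "sqrt (X / N) = sqrt (N * X) / sqrt (N\<^sup>2)"
    by (simp only: real_sqrt_divide)
  then show ?thesis
    using assms by simp
qed

text \<open>Arithmetic-geometric mean inequality, with equality at \<open>Y = B\<close>. It
  linearizes the root of a random \<open>Y\<close>, so that its expectation can be taken, and does
  the work of Jensen's inequality.\<close>

lemma two_sqrt_le:
  fixes B Y :: real
  assumes "0 < B" "0 \<le> Y"
  shows "2 * sqrt Y \<le> Y / sqrt B + sqrt B"
proof -
  have "0 \<le> (sqrt Y - sqrt B)\<^sup>2"
    by simp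
  then have "2 * sqrt Y * sqrt B \<le> Y + sqrt B * sqrt B"
    using assms by (simp add: power2_diff)
  then show ?thesis
    using assms by (simp add: field_simps)
qed

text \<open>The starting point and the initial surrogates are the same on every path, which makes
  the initial gap a number rather than a random variable.\<close>

locale recurrent_problem =
  finite_sum_problem \<Theta> \<pi> f L + sampled_process M v \<theta>
  for \<Theta> :: "'a::euclidean_space set" and \<pi> :: "'v::finite \<Rightarrow> real"
    and f :: "'v \<Rightarrow> 'a \<Rightarrow> real" and L :: real
    and M :: "'w measure" and v :: "nat \<Rightarrow> 'w \<Rightarrow> 'v" and \<theta> :: "nat \<Rightarrow> 'w \<Rightarrow> 'a" +
  fixes g :: "nat \<Rightarrow> 'w \<Rightarrow> 'v \<Rightarrow> 'a \<Rightarrow> real" and \<theta>0 :: 'a and g0 :: "'v \<Rightarrow> 'a \<Rightarrow> real"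
  assumes initial_iterate: "\<And>\<omega>. \<omega> \<in> space M \<Longrightarrow> \<theta> 0 \<omega> = \<theta>0"
    and initial_surrogate: "\<And>\<omega>. \<omega> \<in> space M \<Longrightarrow> g 0 \<omega> = g0"
begin

definition "T = L * enn2real (t_odot M \<pi> v \<theta>)"
definition "\<Delta> = initial_gap \<Theta> \<pi> f g0 \<theta>0"
definition "D n \<omega> = norm (\<theta> n \<omega> - \<theta> (n - 1) \<omega>)"

lemma T_nonneg: "0 \<le> T"
  using L_pos unfolding T_def by simp

lemma D_nonneg: "0 \<le> D n \<omega>"
  unfolding D_def by simp

lemma D_history_measurable: "D n \<in> borel_measurable (history M v \<theta> n)"
proof -
  have [measurable]: "\<theta> n \<in> borel_measurable (history M v \<theta> n)"
      "\<theta> (n - 1) \<in> borel_measurable (history M v \<theta> n)"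
    by (auto intro: iterate_history_measurable)
  show ?thesis
    unfolding D_def[abs_def] by measurable
qed

lemma D_measurable [measurable]: "D n \<in> borel_measurable M"
  by (rule borel_measurable_history[OF D_history_measurable])

lemma nn_integral_le_const:
  assumes "\<And>\<omega>. \<omega> \<in> space M \<Longrightarrow> c \<omega> \<le> (B :: real)"
  shows "(\<integral>\<^sup>+\<omega>. ennreal (c \<omega>) \<partial>M) \<le> ennreal B"
proof -
  have "(\<integral>\<^sup>+\<omega>. ennreal (c \<omega>) \<partial>M) \<le> (\<integral>\<^sup>+\<omega>. ennreal B \<partial>M)"
    using assms by (intro nn_integral_mono ennreal_leI)
  then show ?thesis
    by (simp add: emeasure_space_1)
qed

text \<open>Common to all variants of Algorithm 1: with unit weights in the mean, only an integral
  of increments remains to be bounded for each choice of regularization.\<close>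

lemma Min_expected_gap_algorithm1_le:
  assumes alg: "\<forall>\<omega>\<in>space M. algorithm1 \<Theta> \<pi> f L \<mu> reg (\<lambda>n. v n \<omega>) (\<lambda>n. \<theta> n \<omega>) (\<lambda>n. g n \<omega>)"
    and reg: "\<And>n \<omega>. 1 \<le> n \<Longrightarrow> 0 \<le> reg (\<lambda>i. v i \<omega>) n"
      "\<And>n. (\<lambda>\<omega>. reg (\<lambda>i. v i \<omega>) n) \<in> borel_measurable M"
    and N: "1 \<le> N"
    and B: "(\<integral>\<^sup>+\<omega>. ennreal ((\<Sum>n=1..N. reg (\<lambda>i. v i \<omega>) n * D n \<omega>) + T * (\<Sum>n=1..N. D n \<omega>)) \<partial>M) \<le> ennreal B"
  shows "(MIN n\<in>{1..N}. expected_gap M \<Theta> (mixture \<pi> f) (\<theta> n)) \<le> ennreal (B / real N)"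
proof -
  note [measurable] = reg(2)
  have "(MIN n\<in>{1..N}. expected_gap M \<Theta> (mixture \<pi> f) (\<theta> n)) \<le> ennreal (B / (\<Sum>n=1..N. 1))"
    unfolding expected_gap_def
  proof (rule Min_nn_integral_le)
    have "(\<integral>\<^sup>+\<omega>. (\<Sum>n=1..N. ennreal 1 * e2ennreal (opt_gap \<Theta> (mixture \<pi> f) (\<theta> n \<omega>))) \<partial>M)
        \<le> (\<integral>\<^sup>+\<omega>. ennreal ((\<Sum>n=1..N. reg (\<lambda>i. v i \<omega>) n * D n \<omega>) + T * (\<Sum>n=1..N. D n \<omega>)) \<partial>M)"
      unfolding T_def
    proof (rule nn_integral_sum_weighted_hit_times_le[OF weight_nonneg weight_sum D_history_measurable D_nonneg])
      show "(\<lambda>\<omega>. \<Sum>n=1..N. reg (\<lambda>i. v i \<omega>) n * D n \<omega>) \<in> borel_measurable M"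
        by measurable
      show "0 \<le> (\<Sum>n=1..N. reg (\<lambda>i. v i \<omega>) n * D n \<omega>)" for \<omega>
        using reg(1) D_nonneg by (intro sum_nonneg mult_nonneg_nonneg) auto
      show "(\<Sum>n=1..N. ennreal 1 * e2ennreal (opt_gap \<Theta> (mixture \<pi> f) (\<theta> n \<omega>)))
          \<le> ennreal (\<Sum>n=1..N. reg (\<lambda>i. v i \<omega>) n * D n \<omega>) + ennreal L *
            (\<Sum>i=1..N. ennreal (D i \<omega>) * (\<Sum>w\<in>UNIV. hit_time (\<lambda>i. v i \<omega>) i w * ennreal (\<pi> w)))"
        if "\<omega> \<in> space M" for \<omega>
        using algorithm1_sum_gap_le[OF bspec[OF alg that] reg(1), of N] unfolding D_def by simp
    qed (use L_pos in auto)
    also note B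
    finally show "(\<integral>\<^sup>+\<omega>. (\<Sum>n=1..N. ennreal 1 * e2ennreal (opt_gap \<Theta> (mixture \<pi> f) (\<theta> n \<omega>))) \<partial>M) \<le> ennreal B" .
  qed (use N in auto)
  then show ?thesis by simp
qed

lemma algorithm1_sum_increments_le_gap:
  assumes alg: "\<forall>\<omega>\<in>space M. algorithm1 \<Theta> \<pi> f L \<mu> reg (\<lambda>n. v n \<omega>) (\<lambda>n. \<theta> n \<omega>) (\<lambda>n. g n \<omega>)"
    and \<omega>: "\<omega> \<in> space M"
  shows "(\<Sum>n=1..N. (reg (\<lambda>i. v i \<omega>) n + \<mu> / 2) * (D n \<omega>)\<^sup>2) \<le> \<Delta>"
  using algorithm1_sum_increments[OF bspec[OF alg \<omega>], of N] initial_iterate[OF \<omega>] initial_surrogate[OF \<omega>]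
  unfolding D_def \<Delta>_def by simp

text \<open>Without regularization only \<open>T\<close> times the path length is left, and strong
  convexity bounds it by a constant on every path.\<close>

lemma strongly_convex_rate:
  assumes alg: "\<forall>\<omega>\<in>space M. algorithm1 \<Theta> \<pi> f L \<mu> (const_reg 0) (\<lambda>n. v n \<omega>) (\<lambda>n. \<theta> n \<omega>) (\<lambda>n. g n \<omega>)"
    and \<mu>: "0 < \<mu>" and N: "1 \<le> N"
  shows "(MIN n\<in>{1..N}. expected_gap M \<Theta> (mixture \<pi> f) (\<theta> n)) \<le> ennreal (T * sqrt (2 * \<Delta> / \<mu>) / sqrt N)"
proof -
  have "(MIN n\<in>{1..N}. expected_gap M \<Theta> (mixture \<pi> f) (\<theta> n))
      \<le> ennreal (T * (sqrt (real N) * sqrt (2 * \<Delta> / \<mu>)) / real N)"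
  proof (rule Min_expected_gap_algorithm1_le[OF alg _ _ N])
    show "(\<integral>\<^sup>+\<omega>. ennreal ((\<Sum>n=1..N. const_reg 0 (\<lambda>i. v i \<omega>) n * D n \<omega>) + T * (\<Sum>n=1..N. D n \<omega>)) \<partial>M)
        \<le> ennreal (T * (sqrt (real N) * sqrt (2 * \<Delta> / \<mu>)))"
    proof (rule nn_integral_le_const)
      fix \<omega> assume \<omega>: "\<omega> \<in> space M"
      have "(\<Sum>n=1..N. D n \<omega>) \<le> sqrt (real N) * sqrt (2 * \<Delta> / \<mu>)"
        using algorithm1_sum_increments_le_gap[OF alg \<omega>, of N]
        by (intro sum_increments_le D_nonneg \<mu>) (simp add: const_reg_def)
      then show "(\<Sum>n=1..N. const_reg 0 (\<lambda>i. v i \<omega>) n * D n \<omega>) + T * (\<Sum>n=1..N. D n \<omega>)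
          \<le> T * (sqrt (real N) * sqrt (2 * \<Delta> / \<mu>))"
        using T_nonneg by (simp add: const_reg_def mult_left_mono)
    qed
  qed (auto simp: const_reg_def)
  also have "T * (sqrt (real N) * sqrt (2 * \<Delta> / \<mu>)) / real N = T * sqrt (2 * \<Delta> / \<mu>) * (sqrt (real N) / real N)"
    by simp
  also have "sqrt (real N) / real N = 1 / sqrt (real N)"
    using sqrt_mult_divide_eq[of "real N" 1] N by (simp add: real_sqrt_divide)
  finally show ?thesis
    by simp
qed

text \<open>This is the case of age \<open>0\<close> in
  \<open>regularized_sum_increments_le\<close>; the weights then sum to \<open>N * T\<close> on
  every path.\<close>

lemma const_reg_rate:
  assumes alg: "\<forall>\<omega>\<in>space M. algorithm1 \<Theta> \<pi> f L \<mu> (const_reg \<rho>) (\<lambda>n. v n \<omega>) (\<lambda>n. \<theta> n \<omega>) (\<lambda>n. g n \<omega>)"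
    and \<rho>: "0 \<le> \<rho>" "\<rho> \<le> T" "T \<le> \<rho> + \<mu>" and N: "1 \<le> N"
  shows "(MIN n\<in>{1..N}. expected_gap M \<Theta> (mixture \<pi> f) (\<theta> n)) \<le> ennreal (2 * sqrt (2 * \<Delta> * T / N))"
proof -
  have "(MIN n\<in>{1..N}. expected_gap M \<Theta> (mixture \<pi> f) (\<theta> n))
      \<le> ennreal (2 * sqrt (2 * \<Delta>) * sqrt (N * T) / real N)"
  proof (rule Min_expected_gap_algorithm1_le[OF alg _ _ N])
    show "(\<integral>\<^sup>+\<omega>. ennreal ((\<Sum>n=1..N. const_reg \<rho> (\<lambda>i. v i \<omega>) n * D n \<omega>) + T * (\<Sum>n=1..N. D n \<omega>)) \<partial>M)
        \<le> ennreal (2 * sqrt (2 * \<Delta>) * sqrt (N * T))"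
    proof (rule nn_integral_le_const)
      fix \<omega> assume \<omega>: "\<omega> \<in> space M"
      show "(\<Sum>n=1..N. const_reg \<rho> (\<lambda>i. v i \<omega>) n * D n \<omega>) + T * (\<Sum>n=1..N. D n \<omega>)
          \<le> 2 * sqrt (2 * \<Delta>) * sqrt (N * T)"
        using regularized_sum_increments_le[of "\<lambda>n. D n \<omega>" N "\<lambda>_. 0" \<rho> T \<mu> \<Delta>]
          algorithm1_sum_increments_le_gap[OF alg \<omega>, of N] D_nonneg T_nonneg \<rho>
        by (simp add: const_reg_def)
    qed
  qed (use \<rho> in \<open>auto simp: const_reg_def\<close>)
  also have "2 * sqrt (2 * \<Delta>) * sqrt (N * T) / real N = 2 * sqrt (2 * \<Delta>) * (sqrt (N * T) / real N)"
    by simp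
  also have "\<dots> = 2 * sqrt (2 * \<Delta> * T / N)"
    using N by (subst sqrt_mult_divide_eq) (simp_all add: real_sqrt_mult real_sqrt_divide)
  finally show ?thesis .
qed

text \<open>The weights now contain the random ages, so the pathwise bound is the root of a random
  sum; it is linearized before the expected age is inserted.\<close>

lemma dyn_reg_rate:
  assumes alg: "\<forall>\<omega>\<in>space M. algorithm1 \<Theta> \<pi> f L \<mu> (dyn_reg \<rho>) (\<lambda>n. v n \<omega>) (\<lambda>n. \<theta> n \<omega>) (\<lambda>n. g n \<omega>)"
    and \<rho>: "0 \<le> \<rho>" "\<rho> \<le> T" "T \<le> \<rho> + \<mu>" and N: "1 \<le> N"
  shows "(MIN n\<in>{1..N}. expected_gap M \<Theta> (mixture \<pi> f) (\<theta> n)) \<le>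
    ennreal (2 * sqrt (2 * \<Delta> * (T + (2 * enn2real (t_hit M v \<theta>) + 1) * log 2 (4 * real CARD('v))) / N))"
proof -
  let ?m = "\<lambda>n \<omega>. dyn_reg 0 (\<lambda>i. v i \<omega>) n"
  define C where "C = (2 * enn2real (t_hit M v \<theta>) + 1) * log 2 (4 * real CARD('v))"
  \<comment> \<open>An upper bound for the expectation of \<open>?Y\<close>, and the point where the
    linearized root is exact.\<close>
  define B where "B = real N * (T + C)"
  have "1 \<le> real CARD('v)"
    by (simp add: Suc_leI)
  then have "0 < log 2 (4 * real CARD('v))"
    by (intro zero_less_log_cancel_iff[THEN iffD2]) linarith+
  then have "0 < C"
    unfolding C_def by (intro mult_pos_pos add_nonneg_pos) auto
  then have B: "0 < B"
    using T_nonneg N unfolding B_def by simp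
  obtain \<omega>0 where "\<omega>0 \<in> space M"
    using not_empty by auto
  \<comment> \<open>With no steps the sum of increments is empty, so the decrease estimate reads
    \<open>0 \<le> \<Delta>\<close>.\<close>
  then have \<Delta>: "0 \<le> \<Delta>"
    using algorithm1_sum_increments_le_gap[OF alg, of \<omega>0 0] by simp
  let ?Y = "\<lambda>\<omega>. \<Sum>n=1..N. T + ?m n \<omega>"
  have Y_nonneg: "0 \<le> ?Y \<omega>" for \<omega>
    using T_nonneg by (intro sum_nonneg add_nonneg_nonneg dyn_reg_bounds) auto
  have m_integrable: "integrable M (?m n)" if "n \<in> {1..N}" for n
    using that by (intro dyn_reg_integrable) simp
  have Y_integrable: "integrable M ?Y"
    using m_integrable by (intro Bochner_Integration.integrable_sum Bochner_Integration.integrable_add) auto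
  have "expectation ?Y = (\<Sum>n=1..N. T + expectation (?m n))"
    using m_integrable by (subst Bochner_Integration.integral_sum) (auto simp: prob_space)
  also have "\<dots> \<le> (\<Sum>n=1..N. T + C)"
    unfolding C_def by (intro sum_mono add_left_mono expectation_dyn_reg_le) auto
  finally have Y_le: "expectation ?Y \<le> B"
    unfolding B_def by simp
  have "(MIN n\<in>{1..N}. expected_gap M \<Theta> (mixture \<pi> f) (\<theta> n)) \<le> ennreal (2 * sqrt (2 * \<Delta>) * sqrt B / real N)"
  proof (rule Min_expected_gap_algorithm1_le[OF alg _ _ N])
    show "0 \<le> dyn_reg \<rho> (\<lambda>i. v i \<omega>) n" if "1 \<le> n" for n \<omega>
      using dyn_reg_bounds(1)[OF that, of "\<lambda>i. v i \<omega>"] \<rho>(1) by (subst dyn_reg_eq) simp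
    have "(\<integral>\<^sup>+\<omega>. ennreal ((\<Sum>n=1..N. dyn_reg \<rho> (\<lambda>i. v i \<omega>) n * D n \<omega>) + T * (\<Sum>n=1..N. D n \<omega>)) \<partial>M)
        \<le> (\<integral>\<^sup>+\<omega>. ennreal (sqrt (2 * \<Delta>) * (?Y \<omega> / sqrt B + sqrt B)) \<partial>M)"
    proof (intro nn_integral_mono ennreal_leI)
      fix \<omega> assume \<omega>: "\<omega> \<in> space M"
      have "(\<Sum>n=1..N. dyn_reg \<rho> (\<lambda>i. v i \<omega>) n * D n \<omega>) + T * (\<Sum>n=1..N. D n \<omega>)
          \<le> 2 * sqrt (2 * \<Delta>) * sqrt (?Y \<omega>)"
        unfolding dyn_reg_eq[of \<rho>]
      proof (rule regularized_sum_increments_le)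
        show "(\<Sum>n=1..N. (\<rho> + ?m n \<omega> + \<mu> / 2) * (D n \<omega>)\<^sup>2) \<le> \<Delta>"
          using algorithm1_sum_increments_le_gap[OF alg \<omega>, of N] unfolding dyn_reg_eq[of \<rho>] .
      qed (use D_nonneg T_nonneg \<rho> dyn_reg_bounds in auto)
      also have "\<dots> = sqrt (2 * \<Delta>) * (2 * sqrt (?Y \<omega>))"
        by simp
      also have "\<dots> \<le> sqrt (2 * \<Delta>) * (?Y \<omega> / sqrt B + sqrt B)"
        using \<Delta> by (intro mult_left_mono two_sqrt_le B Y_nonneg) auto
      finally show "(\<Sum>n=1..N. dyn_reg \<rho> (\<lambda>i. v i \<omega>) n * D n \<omega>) + T * (\<Sum>n=1..N. D n \<omega>)
          \<le> sqrt (2 * \<Delta>) * (?Y \<omega> / sqrt B + sqrt B)" .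
    qed
    also have "\<dots> = ennreal (expectation (\<lambda>\<omega>. sqrt (2 * \<Delta>) * (?Y \<omega> / sqrt B + sqrt B)))"
      using Y_integrable Y_nonneg B \<Delta>
      by (intro nn_integral_eq_integral integrable_mult_right Bochner_Integration.integrable_add
          integrable_divide integrable_const AE_I2) auto
    also have "expectation (\<lambda>\<omega>. sqrt (2 * \<Delta>) * (?Y \<omega> / sqrt B + sqrt B)) = sqrt (2 * \<Delta>) * (expectation ?Y / sqrt B + sqrt B)"
    proof -
      have "expectation (\<lambda>\<omega>. ?Y \<omega> / sqrt B + sqrt B) = expectation (\<lambda>\<omega>. ?Y \<omega> / sqrt B) + expectation (\<lambda>\<omega>. sqrt B)"
        using Y_integrable by (intro Bochner_Integration.integral_add integrable_divide) auto
      then show ?thesis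
        using Y_integrable by (simp add: prob_space)
    qed
    also have "ennreal \<dots> \<le> ennreal (sqrt (2 * \<Delta>) * (B / sqrt B + sqrt B))"
      using Y_le \<Delta> B by (intro ennreal_leI mult_left_mono add_right_mono divide_right_mono) auto
    \<comment> \<open>Both summands equal \<open>sqrt B\<close>, so the linearization loses nothing
      here.\<close>
    also have "sqrt (2 * \<Delta>) * (B / sqrt B + sqrt B) = 2 * sqrt (2 * \<Delta>) * sqrt B"
      using B by (simp add: real_div_sqrt)
    finally show "(\<integral>\<^sup>+\<omega>. ennreal ((\<Sum>n=1..N. dyn_reg \<rho> (\<lambda>i. v i \<omega>) n * D n \<omega>) + T * (\<Sum>n=1..N. D n \<omega>)) \<partial>M)
        \<le> ennreal (2 * sqrt (2 * \<Delta>) * sqrt B)" .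
  qed simp
  also have "2 * sqrt (2 * \<Delta>) * sqrt B / real N = 2 * sqrt (2 * \<Delta>) * (sqrt B / real N)"
    by simp
  also have "\<dots> = 2 * sqrt (2 * \<Delta> * (T + C) / N)"
    unfolding B_def using N by (subst sqrt_mult_divide_eq) (simp_all add: real_sqrt_mult real_sqrt_divide)
  finally show ?thesis
    unfolding C_def .
qed

text \<open>The squared radii are deterministic and take the place of the increments, so both the
  hitting-time term and the telescoped term become constants.\<close>

lemma diminishing_radius_rate:
  assumes alg: "\<forall>\<omega>\<in>space M. algorithm2 \<Theta> \<pi> f L r (\<lambda>n. v n \<omega>) (\<lambda>n. \<theta> n \<omega>) (\<lambda>n. g n \<omega>)"
    and smooth: "\<And>w. has_lipschitz_gradient L (f w) (F w)"
    and r: "\<And>n. 1 \<le> n \<Longrightarrow> 0 < r n \<and> r (Suc n) \<le> r n" and N: "1 \<le> N"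
  shows "0 \<le> \<Delta>"
    and "(MIN n\<in>{1..N}. expected_gap M \<Theta> (mixture \<pi> f) (\<theta> n)) \<le>
      ennreal ((\<Delta> + (L + T) * (\<Sum>n=1..N. (r n)\<^sup>2)) / (\<Sum>n=1..N. min 1 (r (n + 1))))"
proof -
  let ?C = "\<Sum>n=1..N. (r n)\<^sup>2"
  obtain \<omega>0 where \<omega>0: "\<omega>0 \<in> space M"
    using not_empty by auto
  have "(INF x\<in>\<Theta>. mixture \<pi> f x) \<le> mixture \<pi> (g 0 \<omega>0) (\<theta> 0 \<omega>0)"
    using bspec[OF alg \<omega>0] unfolding algorithm2_def
    by (intro Inf_le_mixture_surrogate[of "surrogates \<Theta> L" "\<lambda>n. v n \<omega>0" "\<lambda>n. \<theta> n \<omega>0" "\<lambda>n. g n \<omega>0"]) auto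
  then show \<Delta>: "0 \<le> \<Delta>"
    using initial_iterate[OF \<omega>0] initial_surrogate[OF \<omega>0] unfolding \<Delta>_def initial_gap_def by simp
  show "(MIN n\<in>{1..N}. expected_gap M \<Theta> (mixture \<pi> f) (\<theta> n)) \<le>
      ennreal ((\<Delta> + (L + T) * ?C) / (\<Sum>n=1..N. min 1 (r (n + 1))))"
    unfolding expected_gap_def
  proof (rule Min_nn_integral_le)
    have "(\<integral>\<^sup>+\<omega>. (\<Sum>n=1..N. ennreal (min 1 (r (n + 1))) * e2ennreal (opt_gap \<Theta> (mixture \<pi> f) (\<theta> n \<omega>))) \<partial>M)
        \<le> (\<integral>\<^sup>+\<omega>. ennreal ((\<Delta> + L * ?C) + T * ?C) \<partial>M)"
      unfolding T_def
    proof (rule nn_integral_sum_weighted_hit_times_le[OF weight_nonneg weight_sum])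
      show "0 \<le> \<Delta> + L * ?C"
        using \<Delta> L_pos by (simp add: sum_nonneg)
      show "(\<Sum>n=1..N. ennreal (min 1 (r (n + 1))) * e2ennreal (opt_gap \<Theta> (mixture \<pi> f) (\<theta> n \<omega>)))
          \<le> ennreal (\<Delta> + L * ?C) + ennreal L *
            (\<Sum>i=1..N. ennreal ((r i)\<^sup>2) * (\<Sum>w\<in>UNIV. hit_time (\<lambda>i. v i \<omega>) i w * ennreal (\<pi> w)))"
        if \<omega>: "\<omega> \<in> space M" for \<omega>
        using algorithm2_sum_gap_le[OF bspec[OF alg \<omega>] smooth r, of N]
          initial_iterate[OF \<omega>] initial_surrogate[OF \<omega>] unfolding \<Delta>_def by simp
    qed (use L_pos in auto)
    also have "\<dots> = ennreal (\<Delta> + (L + T) * ?C)"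
      by (simp add: emeasure_space_1 algebra_simps)
    finally show "(\<integral>\<^sup>+\<omega>. (\<Sum>n=1..N. ennreal (min 1 (r (n + 1))) * e2ennreal (opt_gap \<Theta> (mixture \<pi> f) (\<theta> n \<omega>))) \<partial>M)
        \<le> ennreal (\<Delta> + (L + T) * ?C)" .
  qed (use N r in auto)
qed

end

theorem theorem3p8:
  fixes M :: "'w measure"
    and \<Theta> :: "'a::euclidean_space set"
    and \<pi> :: "'v::finite \<Rightarrow> real"
    and f :: "'v \<Rightarrow> 'a \<Rightarrow> real"
    and L \<rho> \<mu> :: real
    and r :: "nat \<Rightarrow> real"
    and v :: "nat \<Rightarrow> 'w \<Rightarrow> 'v"
    and \<theta> :: "nat \<Rightarrow> 'w \<Rightarrow> 'a"
    and g :: "nat \<Rightarrow> 'w \<Rightarrow> 'v \<Rightarrow> 'a \<Rightarrow> real"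
    and \<theta>0 :: 'a
    and g0 :: "'v \<Rightarrow> 'a \<Rightarrow> real"
    and N :: nat
  assumes "prob_space M"
    and "\<And>w. 0 \<le> \<pi> w" and "(\<Sum>w\<in>UNIV. \<pi> w) = 1"
    and "\<Theta> \<noteq> {}" and "convex \<Theta>"
    and "\<And>w. bdd_below (f w ` \<Theta>)"
    and "\<And>w x y. x \<in> \<Theta> \<Longrightarrow> y \<in> \<Theta> \<Longrightarrow> \<exists>l. has_dir_deriv (f w) x (y - x) l"
    and "0 < L" and "0 \<le> \<rho>" and "0 \<le> \<mu>"
    and "\<And>n. 1 \<le> n \<Longrightarrow> v n \<in> measurable M (count_space UNIV)"
    and "\<And>n. \<theta> n \<in> borel_measurable M"
    and "\<And>\<omega>. \<omega> \<in> space M \<Longrightarrow> \<theta> 0 \<omega> = \<theta>0"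
    and "\<And>\<omega>. \<omega> \<in> space M \<Longrightarrow> g 0 \<omega> = g0"
    and "recurrent M v \<theta>"
    and "1 \<le> N"
  shows
    "((\<forall>\<omega>\<in>space M. algorithm1 \<Theta> \<pi> f L \<mu> (const_reg \<rho>)
          (\<lambda>n. v n \<omega>) (\<lambda>n. \<theta> n \<omega>) (\<lambda>n. g n \<omega>)) \<longrightarrow>
     \<rho> = 0 \<longrightarrow> 0 < \<mu> \<longrightarrow>
       (MIN n\<in>{1..N}. expected_gap M \<Theta> (mixture \<pi> f) (\<theta> n)) \<le>
         ennreal (L * enn2real (t_odot M \<pi> v \<theta>) * sqrt (2 * initial_gap \<Theta> \<pi> f g0 \<theta>0 / \<mu>) / sqrt N)) \<and>
     ((\<forall>\<omega>\<in>space M. algorithm1 \<Theta> \<pi> f L \<mu> (const_reg \<rho>)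
          (\<lambda>n. v n \<omega>) (\<lambda>n. \<theta> n \<omega>) (\<lambda>n. g n \<omega>)) \<longrightarrow>
     \<rho> \<le> L * enn2real (t_odot M \<pi> v \<theta>) \<longrightarrow> L * enn2real (t_odot M \<pi> v \<theta>) \<le> \<rho> + \<mu> \<longrightarrow>
       (MIN n\<in>{1..N}. expected_gap M \<Theta> (mixture \<pi> f) (\<theta> n)) \<le>
         ennreal (2 * sqrt (2 * initial_gap \<Theta> \<pi> f g0 \<theta>0 * L * enn2real (t_odot M \<pi> v \<theta>) / N))) \<and>
     ((\<forall>\<omega>\<in>space M. algorithm1 \<Theta> \<pi> f L \<mu> (dyn_reg \<rho>)
          (\<lambda>n. v n \<omega>) (\<lambda>n. \<theta> n \<omega>) (\<lambda>n. g n \<omega>)) \<longrightarrow>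
     \<rho> \<le> L * enn2real (t_odot M \<pi> v \<theta>) \<longrightarrow> L * enn2real (t_odot M \<pi> v \<theta>) \<le> \<rho> + \<mu> \<longrightarrow>
       (MIN n\<in>{1..N}. expected_gap M \<Theta> (mixture \<pi> f) (\<theta> n)) \<le>
         ennreal (2 * sqrt (2 * initial_gap \<Theta> \<pi> f g0 \<theta>0 *
           (L * enn2real (t_odot M \<pi> v \<theta>) +
            (2 * enn2real (t_hit M v \<theta>) + 1) * log 2 (4 * real CARD('v))) / N))) \<and>
     ((\<forall>\<omega>\<in>space M. algorithm2 \<Theta> \<pi> f L r
          (\<lambda>n. v n \<omega>) (\<lambda>n. \<theta> n \<omega>) (\<lambda>n. g n \<omega>)) \<longrightarrow>
     (\<forall>w. \<exists>G. has_lipschitz_gradient L (f w) G \<and> continuous_on UNIV G) \<longrightarrow>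
     (\<forall>n\<ge>1. 0 < r n \<and> r (Suc n) \<le> r n) \<longrightarrow>
     \<not> summable (\<lambda>n. r (Suc n)) \<longrightarrow> summable (\<lambda>n. (r (Suc n))\<^sup>2) \<longrightarrow>
     0 < (MIN w. \<pi> w) \<longrightarrow>
       (MIN n\<in>{1..N}. expected_gap M \<Theta> (mixture \<pi> f) (\<theta> n)) \<le>
         ennreal ((initial_gap \<Theta> \<pi> f g0 \<theta>0
             + sqrt (2 * L / (MIN w. \<pi> w) * (\<Sum>n=1..N. (r n)\<^sup>2) * initial_gap \<Theta> \<pi> f g0 \<theta>0)
             + (3 + enn2real (t_odot M \<pi> v \<theta>)) * (\<Sum>n=1..N. (r n)\<^sup>2) * L)
           / (\<Sum>n=1..N. min 1 (r (n + 1)))))"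
proof -
  let ?t = "enn2real (t_odot M \<pi> v \<theta>)" and ?C = "\<Sum>n=1..N. (r n)\<^sup>2"
  interpret recurrent_problem \<Theta> \<pi> f L M v \<theta> g \<theta>0 g0
    using assms
    by (intro recurrent_problem.intro finite_sum_problem.intro sampled_process.intro
        sampled_process_axioms.intro recurrent_problem_axioms.intro) auto
  show ?thesis
  proof (intro conjI impI)
    assume "\<forall>\<omega>\<in>space M. algorithm1 \<Theta> \<pi> f L \<mu> (const_reg \<rho>) (\<lambda>n. v n \<omega>) (\<lambda>n. \<theta> n \<omega>) (\<lambda>n. g n \<omega>)"
      and "\<rho> = 0" "0 < \<mu>"
    then show "(MIN n\<in>{1..N}. expected_gap M \<Theta> (mixture \<pi> f) (\<theta> n)) \<le>
        ennreal (L * ?t * sqrt (2 * initial_gap \<Theta> \<pi> f g0 \<theta>0 / \<mu>) / sqrt N)"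
      using strongly_convex_rate[of \<mu> N] assms(16) unfolding T_def \<Delta>_def by simp
  next
    assume "\<forall>\<omega>\<in>space M. algorithm1 \<Theta> \<pi> f L \<mu> (const_reg \<rho>) (\<lambda>n. v n \<omega>) (\<lambda>n. \<theta> n \<omega>) (\<lambda>n. g n \<omega>)"
      and "\<rho> \<le> L * ?t" "L * ?t \<le> \<rho> + \<mu>"
    then show "(MIN n\<in>{1..N}. expected_gap M \<Theta> (mixture \<pi> f) (\<theta> n)) \<le>
        ennreal (2 * sqrt (2 * initial_gap \<Theta> \<pi> f g0 \<theta>0 * L * ?t / N))"
      using const_reg_rate[of \<mu> \<rho> N] assms(9,16) unfolding T_def \<Delta>_def by (simp add: mult.assoc)
  next
    assume "\<forall>\<omega>\<in>space M. algorithm1 \<Theta> \<pi> f L \<mu> (dyn_reg \<rho>) (\<lambda>n. v n \<omega>) (\<lambda>n. \<theta> n \<omega>) (\<lambda>n. g n \<omega>)"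
      and "\<rho> \<le> L * ?t" "L * ?t \<le> \<rho> + \<mu>"
    then show "(MIN n\<in>{1..N}. expected_gap M \<Theta> (mixture \<pi> f) (\<theta> n)) \<le>
        ennreal (2 * sqrt (2 * initial_gap \<Theta> \<pi> f g0 \<theta>0 *
          (L * ?t + (2 * enn2real (t_hit M v \<theta>) + 1) * log 2 (4 * real CARD('v))) / N))"
      using dyn_reg_rate[of \<mu> \<rho> N] assms(9,16) unfolding T_def \<Delta>_def by simp
  next
    assume alg: "\<forall>\<omega>\<in>space M. algorithm2 \<Theta> \<pi> f L r (\<lambda>n. v n \<omega>) (\<lambda>n. \<theta> n \<omega>) (\<lambda>n. g n \<omega>)"
      and smooth: "\<forall>w. \<exists>G. has_lipschitz_gradient L (f w) G \<and> continuous_on UNIV G"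
      and r: "\<forall>n\<ge>1. 0 < r n \<and> r (Suc n) \<le> r n" and \<pi>_min: "0 < (MIN w. \<pi> w)"
    obtain F where F: "\<And>w. has_lipschitz_gradient L (f w) (F w)"
      using smooth by metis
    note rate = diminishing_radius_rate[OF alg F r[rule_format] assms(16)]
    have C: "0 \<le> ?C"
      by (simp add: sum_nonneg)
    \<comment> \<open>Since \<open>T = L * ?t\<close>, the last term on the right exceeds
      \<open>(L + T) * ?C\<close> by \<open>2 * (L * ?C)\<close>.\<close>
    have "\<Delta> + (L + T) * ?C \<le> \<Delta> + sqrt (2 * L / (MIN w. \<pi> w) * ?C * \<Delta>) + (3 + ?t) * ?C * L"
    proof -
      \<comment> \<open>The sign of the radicand has to be checked, because \<open>sqrt\<close> of a
        negative real is negative; \<open>rate(1)\<close> supplies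
        \<open>0 \<le> \<Delta>\<close>.\<close>
      have "0 \<le> sqrt (2 * L / (MIN w. \<pi> w) * ?C * \<Delta>)"
        using L_pos
        by (intro real_sqrt_ge_zero mult_nonneg_nonneg divide_nonneg_nonneg less_imp_le[OF \<pi>_min] rate(1) C) auto
      moreover have "(3 + ?t) * ?C * L = (L + T) * ?C + 2 * (L * ?C)"
        unfolding T_def by (simp add: algebra_simps)
      moreover have "0 \<le> L * ?C"
        using L_pos C by simp
      ultimately show ?thesis by linarith
    qed
    moreover have "0 \<le> (\<Sum>n=1..N. min 1 (r (n + 1)))"
      using r by (intro sum_nonneg) (auto simp: less_imp_le)
    ultimately have "ennreal ((\<Delta> + (L + T) * ?C) / (\<Sum>n=1..N. min 1 (r (n + 1))))
        \<le> ennreal ((\<Delta> + sqrt (2 * L / (MIN w. \<pi> w) * ?C * \<Delta>) + (3 + ?t) * ?C * L) / (\<Sum>n=1..N. min 1 (r (n + 1))))"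
      by (intro ennreal_leI divide_right_mono)
    with rate(2) show "(MIN n\<in>{1..N}. expected_gap M \<Theta> (mixture \<pi> f) (\<theta> n)) \<le>
        ennreal ((initial_gap \<Theta> \<pi> f g0 \<theta>0
            + sqrt (2 * L / (MIN w. \<pi> w) * ?C * initial_gap \<Theta> \<pi> f g0 \<theta>0)
            + (3 + ?t) * ?C * L) / (\<Sum>n=1..N. min 1 (r (n + 1))))"
      unfolding \<Delta>_def by (rule order_trans)
  qed
qed

end
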